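(* Suppose $a>0$, $0\le c<1$ and $a+c<3$. Define $$D_{a,c}(t)=q_1+(q_1-q_2)t+e^{-a}\int_0^1 w_{a,c}(s)\bigl[e^{(1-s)t}-1-(1-s)t\bigr]\,ds,\qquad \Phi_{a,c}(t)=e^{a-t}D_{a,c}(t).$$ Both functions are entire in $t$, and $\Phi_{a,c}\in L^1(0,\infty)$. For $y>0$, $$e^a-H_{a,c}(y)=\int_0^\infty e^{-yt}\Phi_{a,c}(t)\,dt .$$ Consequently, $$H_{a,c}\text{ is a Bernstein function}\iff D_{a,c}(t)\ge 0\ \text{ for every } t\ge 0 .$$ For every integer $n\ge 2$, $$D_{a,c}^{(n)}(t)=e^{-a}\int_0^1 (1-s)^n w_{a,c}(s)e^{(1-s)t}\,ds .$$
   Context: A function $g\in C^\infty(0,\infty)$ is completely monotone if $(-1)^n g^{(n)}\ge 0$ on $(0,\infty)$ for every integer $n\ge 0$. A nonnegative smooth function $f$ on $(0,\infty)$ is a Bernstein function if $f'$ is completely monotone. For $a>0$, $0\le c<1$, $y>0$: $H_{a,c}(y)=\left(1+\frac1y\right)^{ay-c}$. Also $$w_{a,c}(s)=\frac1\pi\left(\frac{s}{1-s}\right)^{as+c}\sin\bigl(\pi(as+c)\bigr)\quad(0<s<1),$$ $$q_1=\frac a2+c,\qquad q_2=\frac a3+\frac c2+\frac12\left(\frac a2+c\right)^2 .$$ *)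

theory Defs
  imports "HOL-Analysis.Analysis"
begin

text \<open>A function on \<open>(0,\<infinity>)\<close> is represented by a total function \<open>real \<Rightarrow> real\<close>; since \<open>(0,\<infinity>)\<close> is
  open, its values outside \<open>(0,\<infinity>)\<close> do not influence any of the following notions.\<close>

definition smooth_on_pos :: "(real \<Rightarrow> real) \<Rightarrow> bool" where
  "smooth_on_pos f \<longleftrightarrow> (\<forall>n::nat. \<forall>x>0. (deriv ^^ n) f differentiable (at x))"

definition completely_monotone :: "(real \<Rightarrow> real) \<Rightarrow> bool" where
  "completely_monotone g \<longleftrightarrow>
     smooth_on_pos g \<and> (\<forall>n::nat. \<forall>x>0. (-1) ^ n * (deriv ^^ n) g x \<ge> 0)"

definition bernstein_function :: "(real \<Rightarrow> real) \<Rightarrow> bool" where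
  "bernstein_function f \<longleftrightarrow>
     smooth_on_pos f \<and> (\<forall>x>0. f x \<ge> 0) \<and> completely_monotone (deriv f)"

definition H_fun :: "real \<Rightarrow> real \<Rightarrow> real \<Rightarrow> real" where
  "H_fun a c y = (1 + 1 / y) powr (a * y - c)"

definition w_fun :: "real \<Rightarrow> real \<Rightarrow> real \<Rightarrow> real" where
  "w_fun a c s = 1 / pi * (s / (1 - s)) powr (a * s + c) * sin (pi * (a * s + c))"

definition q1 :: "real \<Rightarrow> real \<Rightarrow> real" where
  "q1 a c = a / 2 + c"

definition q2 :: "real \<Rightarrow> real \<Rightarrow> real" where
  "q2 a c = a / 3 + c / 2 + 1 / 2 * (a / 2 + c)\<^sup>2"

text \<open>The functions \<open>D\<close> and \<open>\<Phi>\<close> are generic in the type of \<open>t\<close>, so that one formula gives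
  both the functions of a real variable and the corresponding functions on the complex plane.\<close>

definition D_integrand ::
    "real \<Rightarrow> real \<Rightarrow> 'a::{real_normed_field,banach,second_countable_topology} \<Rightarrow> real \<Rightarrow> 'a" where
  "D_integrand a c t s =
     of_real (w_fun a c s) * (exp (of_real (1 - s) * t) - 1 - of_real (1 - s) * t)"

definition D_fun ::
    "real \<Rightarrow> real \<Rightarrow> 'a::{real_normed_field,banach,second_countable_topology} \<Rightarrow> 'a" where
  "D_fun a c t = of_real (q1 a c) + of_real (q1 a c - q2 a c) * t
     + of_real (exp (- a)) * (LBINT s:{0<..<1}. D_integrand a c t s)"

definition Phi_fun ::
    "real \<Rightarrow> real \<Rightarrow> 'a::{real_normed_field,banach,second_countable_topology} \<Rightarrow> 'a" where
  "Phi_fun a c t = exp (of_real a - t) * D_fun a c t"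

definition D_deriv_integrand ::
    "real \<Rightarrow> real \<Rightarrow> nat \<Rightarrow> 'a::{real_normed_field,banach,second_countable_topology} \<Rightarrow> real \<Rightarrow> 'a" where
  "D_deriv_integrand a c n t s =
     of_real ((1 - s) ^ n * w_fun a c s) * exp (of_real (1 - s) * t)"

lemma D_fun_complex_of_real:
  "D_fun a c (complex_of_real t) = complex_of_real (D_fun a c t)"
proof -
  have "indicator {0<..<1} s *\<^sub>R D_integrand a c (complex_of_real t) s
      = complex_of_real (indicator {0<..<1} s *\<^sub>R D_integrand a c t s)" for s
    by (simp add: D_integrand_def exp_of_real [symmetric] scaleR_conv_of_real)
  then have "(LBINT s:{0<..<1}. D_integrand a c (complex_of_real t) s)
      = complex_of_real (LBINT s:{0<..<1}. D_integrand a c t s)"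
    unfolding set_lebesgue_integral_def by (simp only: integral_complex_of_real)
  then show ?thesis
    by (simp add: D_fun_def)
qed

lemma Phi_fun_complex_of_real:
  "Phi_fun a c (complex_of_real t) = complex_of_real (Phi_fun a c t)"
  by (simp add: Phi_fun_def D_fun_complex_of_real exp_of_real flip: of_real_diff)

end

theory Submission
  imports Defs "HOL-Complex_Analysis.Complex_Analysis" "HOL-Real_Asymp.Real_Asymp"
begin

text \<open>The identity \<open>H = e\<^sup>a - \<L>\<Phi>\<close> comes from Cauchy's theorem. The function \<open>H\<close> extends holomorphically
to the complement of the cut \<open>[-1,0]\<close>, tends to \<open>e\<^sup>a\<close> at infinity, and its jump across the cut at \<open>-s\<close>
is a multiple of \<open>w(s)\<close>. The singularity of \<open>w\<close> at \<open>s = 1\<close> is of order \<open>(1-s)\<close> to the power \<open>-(a+c)\<close>, so the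
factor \<open>(1+z)\<^sup>2\<close> makes the jump integrable because \<open>a + c < 3\<close>. The Cauchy integral formula for
\<open>(1+z)\<^sup>2 H(z)\<close>, whose polynomial part at infinity involves \<open>q\<^sub>1\<close> and \<open>q\<^sub>2\<close>, is then
\<open>(1+y)\<^sup>2 (e\<^sup>a - H(y)) = e\<^sup>a (q\<^sub>1 (1+y) + q\<^sub>1 - q\<^sub>2) + \<integral> w(s) (1-s)\<^sup>2 / (y+s) ds\<close>
(\<open>H_fun_integral_representation\<close>).

Contours around a cut are avoided by the substitution \<open>1 + 1/z = e\<^sup>\<zeta>\<close>. It maps the cut plane with the
point at infinity to the strip \<open>|Im \<zeta>| < \<pi>\<close>, with infinity going to \<open>\<zeta> = 0\<close> and the two sides of the cut to
the lines \<open>Im \<zeta> = \<pi>\<close> and \<open>Im \<zeta> = -\<pi>\<close>, across which \<open>H\<close> continues analytically. So the residue theorem on the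
rectangles \<open>[-R,R] \<times> [-\<pi>,\<pi>]\<close> suffices. There are two residues, a simple one
at \<open>\<zeta> = ln (1 + 1/y)\<close> which gives \<open>H(y)\<close>, and one of order three at \<open>\<zeta> = 0\<close> which gives the polynomial part.

Dividing by \<open>(1+y)\<^sup>2\<close> and reading each term as a Laplace transform in \<open>y\<close> produces \<open>\<Phi>\<close>: indeed
\<open>(1-s)\<^sup>2 / ((y+s)(1+y)\<^sup>2)\<close> is the transform of \<open>e\<^sup>-\<^sup>t (exp ((1-s)t) - 1 - (1-s)t)\<close>, and Fubini's theorem applies
because \<open>|w(s)| (1-s)\<^sup>2 / s\<close> is integrable (\<open>laplace_Phi_fun\<close>). The case \<open>y = 0\<close> gives \<open>\<Phi> \<in> L\<^sup>1\<close>.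

Differentiating under the Laplace integral, the sign conditions for \<open>H\<close> to be a Bernstein function say that
\<open>\<integral> t\<^sup>n e\<^sup>-\<^sup>y\<^sup>t \<Phi>(t) dt \<ge> 0\<close> for all \<open>n \<ge> 1\<close> and \<open>y > 0\<close>. This clearly holds if \<open>\<Phi> \<ge> 0\<close>. Conversely,
for \<open>y = n/t\<^sub>0\<close> the kernel \<open>t\<^sup>n e\<^sup>-\<^sup>y\<^sup>t\<close> concentrates at \<open>t\<^sub>0\<close> as \<open>n\<close> grows, so a point with
\<open>\<Phi>(t\<^sub>0) < 0\<close> would make some integral negative (\<open>laplace_moment_neg\<close>).

Finally, all \<open>t\<close>-derivatives of the integrand of \<open>D\<close> are bounded by a multiple of \<open>|w(s)| (1-s)\<^sup>2\<close>, locally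
uniformly in \<open>t\<close>, so that \<open>D\<close> is entire and may be differentiated under the integral.\<close>

section \<open>Differentiation under the integral sign\<close>

lemma norm_exp_minus_1_minus_self_le:
  fixes z :: "'a::{real_normed_field,banach}"
  shows "norm (exp z - 1 - z) \<le> (norm z)\<^sup>2 * exp (norm z)"
proof -
  have "exp z - 1 - z = (\<Sum>n. inverse (fact (n + 2)) *\<^sub>R z ^ (n + 2))"
    by (subst exp_first_two_terms) simp
  also have "norm \<dots> \<le> (\<Sum>n. (norm z)\<^sup>2 * (norm z ^ n /\<^sub>R fact n))"
  proof (rule norm_suminf_le)
    fix n
    have "inverse (fact (n + 2)) \<le> (inverse (fact n) :: real)"
      by (intro le_imp_inverse_le fact_mono) auto
    then have "norm z ^ (n + 2) * inverse (fact (n + 2)) \<le> norm z ^ (n + 2) * inverse (fact n)"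
      by (rule mult_left_mono) auto
    then show "norm (inverse (fact (n + 2)) *\<^sub>R z ^ (n + 2)) \<le> (norm z)\<^sup>2 * (norm z ^ n /\<^sub>R fact n)"
      by (simp add: norm_mult norm_power power_add power2_eq_square mult_ac divide_inverse)
  next
    show "summable (\<lambda>n. (norm z)\<^sup>2 * (norm z ^ n /\<^sub>R fact n))"
      by (intro summable_mult summable_exp_generic)
  qed
  also have "\<dots> = (norm z)\<^sup>2 * exp (norm z)"
    by (subst suminf_mult[OF summable_exp_generic]) (simp add: exp_def)
  finally show ?thesis .
qed

lemma norm_exp_minus_1_le:
  fixes z :: "'a::{real_normed_field,banach}"
  shows "norm (exp z - 1) \<le> norm z * exp (norm z)"
proof -
  have "exp z - 1 = (\<Sum>n. inverse (fact (n + 1)) *\<^sub>R z ^ (n + 1))"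
    by (subst exp_first_term) simp
  also have "norm \<dots> \<le> (\<Sum>n. norm z * (norm z ^ n /\<^sub>R fact n))"
  proof (rule norm_suminf_le)
    fix n
    have "inverse (fact (n + 1)) \<le> (inverse (fact n) :: real)"
      by (intro le_imp_inverse_le fact_mono) auto
    then have "norm z ^ (n + 1) * inverse (fact (n + 1)) \<le> norm z ^ (n + 1) * inverse (fact n)"
      by (rule mult_left_mono) auto
    then show "norm (inverse (fact (n + 1)) *\<^sub>R z ^ (n + 1)) \<le> norm z * (norm z ^ n /\<^sub>R fact n)"
      by (simp add: norm_mult norm_power power_add mult_ac divide_inverse)
  next
    show "summable (\<lambda>n. norm z * (norm z ^ n /\<^sub>R fact n))"
      by (intro summable_mult summable_exp_generic)
  qed
  also have "\<dots> = norm z * exp (norm z)"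
    by (subst suminf_mult[OF summable_exp_generic]) (simp add: exp_def)
  finally show ?thesis .
qed

text \<open>A first-order Taylor expansion of the integrand with an integrable quadratic remainder can simply be
integrated. The result serves both for \<open>D\<close>, over the reals and over the complex numbers, and for Laplace
transforms.\<close>

lemma has_field_derivative_integral_quadratic_remainder:
  fixes f :: "'a \<Rightarrow> 'b \<Rightarrow> 'a::{real_normed_field,banach,second_countable_topology}"
  assumes \<delta>: "\<delta> > 0"
    and f: "\<And>h. norm h < \<delta> \<Longrightarrow> integrable M (f (t + h))"
    and f': "integrable M f'" and B: "integrable M B"
    and le: "\<And>h s. norm h < \<delta> \<Longrightarrow> s \<in> space M \<Longrightarrow>
               norm (f (t + h) s - f t s - h * f' s) \<le> (norm h)\<^sup>2 * B s"
  shows "((\<lambda>t. \<integral>s. f t s \<partial>M) has_field_derivative (\<integral>s. f' s \<partial>M)) (at t)"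
proof -
  let ?F = "\<lambda>t. \<integral>s. f t s \<partial>M" and ?D = "\<integral>s. f' s \<partial>M"
  have ft: "integrable M (f t)"
    using f[of 0] \<delta> by simp
  have "norm ((?F (t + h) - ?F t) / h - ?D) \<le> norm h * (\<integral>s. B s \<partial>M)" if h: "norm h < \<delta>" "h \<noteq> 0" for h
  proof -
    have "?F (t + h) - ?F t - h * ?D = (\<integral>s. f (t + h) s - f t s - h * f' s \<partial>M)"
      using f[OF h(1)] ft f' by simp
    also have "norm \<dots> \<le> (\<integral>s. (norm h)\<^sup>2 * B s \<partial>M)"
      using f[OF h(1)] ft f' B le[OF h(1)]
      by (intro order_trans[OF integral_norm_bound integral_mono]) auto
    finally have "norm (?F (t + h) - ?F t - h * ?D) \<le> (norm h)\<^sup>2 * (\<integral>s. B s \<partial>M)"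
      by simp
    moreover have "(?F (t + h) - ?F t) / h - ?D = (?F (t + h) - ?F t - h * ?D) / h"
      using h by (simp add: field_simps)
    ultimately show ?thesis
      using h by (simp add: norm_divide divide_le_eq power2_eq_square mult_ac)
  qed
  then have "\<forall>\<^sub>F h in at 0. norm ((?F (t + h) - ?F t) / h - ?D) \<le> norm h * (\<integral>s. B s \<partial>M)"
    using \<delta> by (auto simp: eventually_at dist_norm)
  moreover have "((\<lambda>h::'a. norm h * (\<integral>s. B s \<partial>M)) \<longlongrightarrow> 0) (at 0)"
    by (auto intro!: tendsto_eq_intros)
  ultimately have "((\<lambda>h. (?F (t + h) - ?F t) / h - ?D) \<longlongrightarrow> 0) (at 0)"
    by (rule Lim_null_comparison)
  then show ?thesis
    unfolding DERIV_def by (rule LIM_zero_cancel)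
qed

section \<open>The weight\<close>

lemma borel_measurable_w_fun [measurable]: "w_fun a c \<in> borel_measurable borel"
  unfolding w_fun_def by measurable

text \<open>The factor \<open>a s + c\<close>, which comes from \<open>|sin x| \<le> |x|\<close>, keeps track of the zero of \<open>w\<close> at \<open>s = 0\<close> in the
case \<open>c = 0\<close>.\<close>
lemma abs_w_fun_le:
  assumes "a > 0" "0 \<le> c" "0 < s" "s < 1"
  shows "\<bar>w_fun a c s\<bar> \<le> (a * s + c) * s powr c * (1 - s) powr - (a + c)"
proof -
  have nn: "0 \<le> a * s + c" using assms by simp
  have as: "a * s \<le> a" using assms by simp
  have "\<bar>w_fun a c s\<bar> = 1 / pi * (s / (1 - s)) powr (a * s + c) * \<bar>sin (pi * (a * s + c))\<bar>"
    by (simp add: w_fun_def abs_mult)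
  also have "\<dots> \<le> 1 / pi * (s / (1 - s)) powr (a * s + c) * (pi * (a * s + c))"
    using nn abs_sin_x_le_abs_x[of "pi * (a * s + c)"]
    by (intro mult_left_mono) (auto simp: abs_mult)
  also have "\<dots> = (a * s + c) * (s powr (a * s + c) * (1 - s) powr - (a * s + c))"
    using assms by (simp add: powr_divide powr_minus_divide[of "1 - s" "a * s + c"] del: minus_add_distrib)
  also have "\<dots> \<le> (a * s + c) * (s powr c * (1 - s) powr - (a + c))"
    using assms nn as
    by (intro mult_left_mono mult_mono) (auto simp: powr_mono_both' intro!: powr_mono')
  finally show ?thesis by (simp add: mult_ac)
qed

text \<open>Both endpoints matter. At \<open>s = 1\<close> the bound behaves like \<open>(1 - s)\<close> to the power \<open>2 - a - c > -1\<close>.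
At \<open>s = 0\<close>, dividing \<open>(a s + c) s\<^sup>c\<close> by \<open>s\<close> leaves \<open>a s\<^sup>c + c s\<^sup>c\<^sup>-\<^sup>1\<close>, which is integrable for \<open>c > 0\<close>
and equal to the constant \<open>a\<close> for \<open>c = 0\<close>. So the integrand is dominated by two Beta integrands.\<close>

lemma integrable_w_fun_weighted:
  assumes "a > 0" "0 \<le> c" "a + c < 3"
  shows "set_integrable lborel {0<..<1} (\<lambda>s. \<bar>w_fun a c s\<bar> * (1 - s)\<^sup>2 / s)"
proof -
  let ?B = "\<lambda>x s::real. s powr (x - 1) * (1 - s) powr (3 - a - c - 1)"
  have I: "set_integrable lborel {0<..<1} (?B x)" if "x > 0" for x
    using integrable_Beta[of x "3 - a - c"] that assms by (rule_tac set_integrable_subset) auto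
  have "set_integrable lborel {0<..<1} (\<lambda>s. c * ?B c s)"
    using I[of c] assms
    by (cases "c = 0") (auto intro!: set_integrable_mult_right simp: set_integrable_def[of _ _ "\<lambda>s. 0"])
  then have "set_integrable lborel {0<..<1} (\<lambda>s. a * ?B (c + 1) s + c * ?B c s)"
    using I[of "c + 1"] assms by (intro set_integral_add set_integrable_mult_right) auto
  then show ?thesis
  proof (rule set_integrable_bound)
    show "set_borel_measurable lborel {0<..<1} (\<lambda>s. \<bar>w_fun a c s\<bar> * (1 - s)\<^sup>2 / s)"
      unfolding set_borel_measurable_def by measurable
    have "\<bar>w_fun a c s\<bar> * (1 - s)\<^sup>2 / s \<le> a * ?B (c + 1) s + c * ?B c s" if s: "0 < s" "s < 1" for s
    proof -
      have p2: "(1 - s) powr - (a + c) * (1 - s)\<^sup>2 = (1 - s) powr (3 - a - c - 1)"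
        using s by (simp add: algebra_simps flip: powr_add powr_numeral)
      have p1: "s powr c = s * s powr (c - 1)"
        using s powr_add[of s 1 "c - 1"] by simp
      have "\<bar>w_fun a c s\<bar> * (1 - s)\<^sup>2 / s
          \<le> (a * s + c) * s powr c * (1 - s) powr - (a + c) * (1 - s)\<^sup>2 / s"
        using abs_w_fun_le[OF assms(1,2) s] s by (intro divide_right_mono mult_right_mono) auto
      also have "\<dots> = (a * s + c) * s powr c * ((1 - s) powr - (a + c) * (1 - s)\<^sup>2) / s"
        by simp
      also have "\<dots> = a * ?B (c + 1) s + c * ?B c s"
        unfolding p2 p1 using s by (simp add: field_simps) (simp add: p1 algebra_simps)
      finally show ?thesis .
    qed
    then have "norm (\<bar>w_fun a c s\<bar> * (1 - s)\<^sup>2 / s) \<le> norm (a * ?B (c + 1) s + c * ?B c s)"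
      if "0 < s" "s < 1" for s
      using that by (auto simp: abs_mult intro: order_trans[OF _ abs_ge_self])
    then show "AE s in lborel. s \<in> {0<..<1} \<longrightarrow>
        norm (\<bar>w_fun a c s\<bar> * (1 - s)\<^sup>2 / s) \<le> norm (a * ?B (c + 1) s + c * ?B c s)"
      by simp
  qed
qed

lemma integrable_w_fun_square:
  assumes "a > 0" "0 \<le> c" "a + c < 3"
  shows "set_integrable lborel {0<..<1} (\<lambda>s. \<bar>w_fun a c s\<bar> * (1 - s)\<^sup>2)"
proof (rule set_integrable_bound[OF integrable_w_fun_weighted[OF assms]])
  show "set_borel_measurable lborel {0<..<1} (\<lambda>s. \<bar>w_fun a c s\<bar> * (1 - s)\<^sup>2)"
    unfolding set_borel_measurable_def by measurable
  have "\<bar>w_fun a c s\<bar> * (1 - s)\<^sup>2 \<le> \<bar>w_fun a c s\<bar> * (1 - s)\<^sup>2 / s" if "0 < s" "s < 1" for s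
    using that mult_left_mono[of s 1 "\<bar>w_fun a c s\<bar> * (1 - s)\<^sup>2"] by (simp add: pos_le_divide_eq)
  then show "AE s in lborel. s \<in> {0<..<1} \<longrightarrow> norm (\<bar>w_fun a c s\<bar> * (1 - s)\<^sup>2)
      \<le> norm (\<bar>w_fun a c s\<bar> * (1 - s)\<^sup>2 / s)"
    by (simp add: abs_mult)
qed

section \<open>The function D and its derivatives\<close>

text \<open>The \<open>n\<close>-th derivative of \<open>exp z - 1 - z\<close>.\<close>

definition exp_tail :: "nat \<Rightarrow> 'a::{real_normed_field,banach} \<Rightarrow> 'a" where
  "exp_tail n z = (if n = 0 then exp z - 1 - z else if n = 1 then exp z - 1 else exp z)"

text \<open>The remainder does not depend on \<open>n\<close>, because \<open>exp z - 1 - z\<close> and all its derivatives differ from \<open>exp\<close> by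
polynomials of degree at most one.\<close>

lemma exp_tail_add:
  "exp_tail n (z + h) - exp_tail n z - h * exp_tail (Suc n) z = exp z * (exp h - 1 - h)"
  by (auto simp: exp_tail_def exp_add algebra_simps)

text \<open>For each of the functions \<open>exp_tail n\<close>, the factor \<open>r\<^sup>n\<close> and the zero at the origin together contribute at
least \<open>r\<^sup>2\<close>. With \<open>r = 1 - s\<close> this is the factor that makes the weight integrable.\<close>

lemma norm_exp_tail_le:
  fixes z :: "'a::{real_normed_field,banach}"
  assumes r: "0 \<le> r" "r \<le> 1"
  shows "r ^ n * norm (exp_tail n (of_real r * z)) \<le> r\<^sup>2 * ((1 + norm z)\<^sup>2 * exp (norm z))"
proof -
  have rz: "norm (of_real r * z) = r * norm z"
    using r by (simp add: norm_mult)
  have e: "exp (r * norm z) \<le> exp (norm z)"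
    using r by (simp add: mult_left_le_one_le)
  consider "n = 0" | "n = 1" | m where "n = m + 2"
    by (metis One_nat_def Suc_1 add.commute le_Suc_ex less_2_cases_iff not_less)
  then show ?thesis
  proof cases
    case 1
    have "norm (exp_tail n (of_real r * z)) \<le> (r * norm z)\<^sup>2 * exp (r * norm z)"
      using norm_exp_minus_1_minus_self_le[of "of_real r * z"] 1 by (simp add: exp_tail_def rz)
    also have "\<dots> \<le> (r * (1 + norm z))\<^sup>2 * exp (norm z)"
      using r e by (intro mult_mono power_mono mult_left_mono) auto
    finally show ?thesis using 1 by (simp add: power_mult_distrib mult_ac)
  next
    case 2
    have "r * norm (exp_tail n (of_real r * z)) \<le> r * ((r * norm z) * exp (r * norm z))"
      using norm_exp_minus_1_le[of "of_real r * z"] 2 r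
      by (intro mult_left_mono) (simp_all add: exp_tail_def rz)
    also have "\<dots> = r\<^sup>2 * (norm z * exp (r * norm z))"
      by (simp add: power2_eq_square)
    also have "\<dots> \<le> r\<^sup>2 * ((1 + norm z)\<^sup>2 * exp (norm z))"
      using e by (intro mult_left_mono mult_mono) (auto simp: power2_eq_square algebra_simps)
    finally show ?thesis using 2 by simp
  next
    case 3
    have "norm (exp_tail n (of_real r * z)) \<le> 1 * exp (norm z)"
      using order_trans[OF norm_exp[of "of_real r * z"]] 3 e by (simp add: exp_tail_def rz)
    also have "\<dots> \<le> (1 + norm z)\<^sup>2 * exp (norm z)"
      by (intro mult_right_mono) (auto simp: power2_eq_square algebra_simps)
    finally have 1: "norm (exp_tail n (of_real r * z)) \<le> (1 + norm z)\<^sup>2 * exp (norm z)" .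
    have "r ^ n \<le> r\<^sup>2"
      using r 3 by (intro power_decreasing) auto
    then show ?thesis
      using 1 r by (intro mult_mono) auto
  qed
qed

text \<open>The \<open>n\<close>-th \<open>t\<close>-derivative of the integrand of \<open>D\<close>.\<close>

definition D_integrand_deriv :: "real \<Rightarrow> real \<Rightarrow> nat \<Rightarrow> 'a::{real_normed_field,banach,second_countable_topology} \<Rightarrow> real \<Rightarrow> 'a" where
  "D_integrand_deriv a c n t s = of_real ((1 - s) ^ n * w_fun a c s) * exp_tail n (of_real (1 - s) * t)"

lemma D_integrand_deriv_0: "D_integrand_deriv a c 0 = D_integrand a c"
  by (simp add: D_integrand_deriv_def D_integrand_def exp_tail_def fun_eq_iff)

lemma D_integrand_deriv_ge_2: "n \<ge> 2 \<Longrightarrow> D_integrand_deriv a c n = D_deriv_integrand a c n"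
  by (auto simp: D_integrand_deriv_def D_deriv_integrand_def exp_tail_def fun_eq_iff)

lemma borel_measurable_exp_tail [measurable]: "exp_tail n \<in> borel_measurable borel"
  unfolding exp_tail_def
  by (intro borel_measurable_continuous_onI) (cases "n = 0"; cases "n = 1"; auto intro!: continuous_intros)

lemma borel_measurable_D_integrand_deriv [measurable]: "D_integrand_deriv a c n t \<in> borel_measurable borel"
  unfolding D_integrand_deriv_def by measurable

lemma set_integrable_D_integrand_deriv:
  fixes t :: "'a::{real_normed_field,banach,second_countable_topology}"
  assumes "a > 0" "0 \<le> c" "a + c < 3"
  shows "set_integrable lborel {0<..<1} (D_integrand_deriv a c n t)"
proof (rule set_integrable_bound)
  show "set_integrable lborel {0<..<1} (\<lambda>s. \<bar>w_fun a c s\<bar> * (1 - s)\<^sup>2 * ((1 + norm t)\<^sup>2 * exp (norm t)))"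
    using integrable_w_fun_square[OF assms] by simp
  show "set_borel_measurable lborel {0<..<1} (D_integrand_deriv a c n t)"
    unfolding set_borel_measurable_def by measurable
  have "norm (D_integrand_deriv a c n t s) \<le> \<bar>w_fun a c s\<bar> * (1 - s)\<^sup>2 * ((1 + norm t)\<^sup>2 * exp (norm t))"
    if "0 < s" "s < 1" for s
    using mult_left_mono[OF norm_exp_tail_le[of "1 - s" n t], of "\<bar>w_fun a c s\<bar>"] that
    by (simp add: D_integrand_deriv_def norm_mult norm_power abs_mult mult_ac flip: of_real_diff of_real_power)
  then show "AE s in lborel. s \<in> {0<..<1} \<longrightarrow> norm (D_integrand_deriv a c n t s) \<le>
      norm (\<bar>w_fun a c s\<bar> * (1 - s)\<^sup>2 * ((1 + norm t)\<^sup>2 * exp (norm t)))"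
    by (auto intro: order_trans[OF _ abs_ge_self])
qed

lemma has_field_derivative_integral_D_integrand_deriv:
  fixes t :: "'a::{real_normed_field,banach,second_countable_topology}"
  assumes "a > 0" "0 \<le> c" "a + c < 3"
  shows "((\<lambda>t. LBINT s:{0<..<1}. D_integrand_deriv a c n t s) has_field_derivative
           (LBINT s:{0<..<1}. D_integrand_deriv a c (Suc n) t s)) (at t)"
  unfolding set_lebesgue_integral_def
proof (rule has_field_derivative_integral_quadratic_remainder[where \<delta> = 1])
  let ?I = "indicat_real {0<..<1}"
  let ?B = "\<lambda>s. ?I s * (\<bar>w_fun a c s\<bar> * (1 - s)\<^sup>2 * (exp (norm t) * exp 1))"
  show "integrable lborel (\<lambda>s. ?I s *\<^sub>R D_integrand_deriv a c n (t + h) s)" for h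
    using set_integrable_D_integrand_deriv[OF assms] by (simp add: set_integrable_def)
  show "integrable lborel (\<lambda>s. ?I s *\<^sub>R D_integrand_deriv a c (Suc n) t s)"
    using set_integrable_D_integrand_deriv[OF assms] by (simp add: set_integrable_def)
  show "integrable lborel ?B"
    using set_integrable_mult_left[OF integrable_w_fun_square[OF assms], of "exp (norm t) * exp 1"]
    by (simp add: set_integrable_def)
  fix h :: 'a and s :: real
  assume h: "norm h < 1"
  have "norm (D_integrand_deriv a c n (t + h) s - D_integrand_deriv a c n t s - h * D_integrand_deriv a c (Suc n) t s)
      \<le> (norm h)\<^sup>2 * (\<bar>w_fun a c s\<bar> * (1 - s)\<^sup>2 * (exp (norm t) * exp 1))" if s: "0 < s" "s < 1"
  proof -
    let ?u = "of_real (1 - s) * t" and ?v = "of_real (1 - s) * h"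
    have "D_integrand_deriv a c n (t + h) s - D_integrand_deriv a c n t s - h * D_integrand_deriv a c (Suc n) t s
        = of_real ((1 - s) ^ n * w_fun a c s) *
            (exp_tail n (?u + ?v) - exp_tail n ?u - ?v * exp_tail (Suc n) ?u)"
      by (simp add: D_integrand_deriv_def algebra_simps)
    also have "\<dots> = of_real ((1 - s) ^ n * w_fun a c s) * (exp ?u * (exp ?v - 1 - ?v))"
      by (simp only: exp_tail_add)
    also have "norm \<dots> = (1 - s) ^ n * (\<bar>w_fun a c s\<bar> * (norm (exp ?u) * norm (exp ?v - 1 - ?v)))"
      using s by (simp add: norm_mult norm_power abs_mult mult_ac flip: of_real_diff of_real_power)
    also have "\<dots> \<le> 1 * (\<bar>w_fun a c s\<bar> * (exp (norm t) * (((1 - s) * norm h)\<^sup>2 * exp 1)))"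
    proof (intro mult_mono order.refl)
      show "norm (exp ?u) \<le> exp (norm t)"
        using s by (intro order_trans[OF norm_exp]) (simp add: norm_mult mult_left_le_one_le del: of_real_diff)
      have "(1 - s) * norm h \<le> 1"
        using s h mult_le_one[of "1 - s" "norm h"] by simp
      then have "((1 - s) * norm h)\<^sup>2 * exp ((1 - s) * norm h) \<le> ((1 - s) * norm h)\<^sup>2 * exp 1"
        by (intro mult_left_mono) auto
      then show "norm (exp ?v - 1 - ?v) \<le> ((1 - s) * norm h)\<^sup>2 * exp 1"
        using norm_exp_minus_1_minus_self_le[of ?v] s by (simp add: norm_mult del: of_real_diff)
    qed (use s in \<open>auto simp: power_le_one\<close>)
    finally show ?thesis
      by (simp add: power_mult_distrib mult_ac)
  qed
  then show "norm (?I s *\<^sub>R D_integrand_deriv a c n (t + h) s - ?I s *\<^sub>R D_integrand_deriv a c n t s - h * (?I s *\<^sub>R D_integrand_deriv a c (Suc n) t s))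
      \<le> (norm h)\<^sup>2 * ?B s"
    by (auto simp: indicator_def)
qed simp

lemma has_field_derivative_D_fun:
  fixes t :: "'a::{real_normed_field,banach,second_countable_topology}"
  assumes "a > 0" "0 \<le> c" "a + c < 3"
  shows "(D_fun a c has_field_derivative
           of_real (q1 a c - q2 a c) + of_real (exp (- a)) * (LBINT s:{0<..<1}. D_integrand_deriv a c 1 t s)) (at t)"
  unfolding D_fun_def[abs_def] D_integrand_deriv_0[symmetric]
  using has_field_derivative_integral_D_integrand_deriv[OF assms, of 0 t]
  by (auto intro!: derivative_eq_intros)

lemma deriv_D_fun:
  fixes t :: "'a::{real_normed_field,banach,second_countable_topology}"
  assumes "a > 0" "0 \<le> c" "a + c < 3" and n: "n \<ge> 2"
  shows "(deriv ^^ n) (D_fun a c) t = of_real (exp (- a)) * (LBINT s:{0<..<1}. D_deriv_integrand a c n t s)"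
proof -
  have "(deriv ^^ (k + 2)) (D_fun a c) = (\<lambda>t::'a. of_real (exp (- a)) * (LBINT s:{0<..<1}. D_integrand_deriv a c (k + 2) t s))" for k
  proof (induction k)
    case 0
    have d1: "deriv (D_fun a c) = (\<lambda>t::'a. of_real (q1 a c - q2 a c)
                 + of_real (exp (- a)) * (LBINT s:{0<..<1}. D_integrand_deriv a c 1 t s))"
      using has_field_derivative_D_fun[OF assms(1-3)] by (blast intro: DERIV_imp_deriv)
    have "((\<lambda>t. of_real (q1 a c - q2 a c) + of_real (exp (- a)) * (LBINT s:{0<..<1}. D_integrand_deriv a c 1 t s))
        has_field_derivative of_real (exp (- a)) * (LBINT s:{0<..<1}. D_integrand_deriv a c 2 t s)) (at t)" for t :: 'a
      using has_field_derivative_integral_D_integrand_deriv[OF assms(1-3), of 1 t]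
      by (auto intro!: derivative_eq_intros simp: numeral_2_eq_2)
    then have "deriv (deriv (D_fun a c)) = (\<lambda>t::'a. of_real (exp (- a)) * (LBINT s:{0<..<1}. D_integrand_deriv a c 2 t s))"
      unfolding d1 by (blast intro: DERIV_imp_deriv)
    then show ?case by (simp add: numeral_2_eq_2)
  next
    case (Suc k)
    have "((\<lambda>t. of_real (exp (- a)) * (LBINT s:{0<..<1}. D_integrand_deriv a c (k + 2) t s))
        has_field_derivative of_real (exp (- a)) * (LBINT s:{0<..<1}. D_integrand_deriv a c (Suc k + 2) t s)) (at t)" for t :: 'a
      using has_field_derivative_integral_D_integrand_deriv[OF assms(1-3), of "k + 2" t]
      by (auto intro!: derivative_eq_intros)
    then have "deriv (\<lambda>t. of_real (exp (- a)) * (LBINT s:{0<..<1}. D_integrand_deriv a c (k + 2) t s)) t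
        = of_real (exp (- a)) * (LBINT s:{0<..<1}. D_integrand_deriv a c (Suc k + 2) t s)" for t :: 'a
      by (blast intro: DERIV_imp_deriv)
    then have "deriv ((deriv ^^ (k + 2)) (D_fun a c))
        = (\<lambda>t::'a. of_real (exp (- a)) * (LBINT s:{0<..<1}. D_integrand_deriv a c (Suc k + 2) t s))"
      unfolding Suc.IH by blast
    then show ?case by simp
  qed
  from this[of "n - 2"] show ?thesis
    using n by (simp only: le_add_diff_inverse2 D_integrand_deriv_ge_2)
qed

section \<open>The Laplace transform of \<Phi>\<close>

lemma has_bochner_integral_FTC_Ioi_nonneg:
  fixes f F :: "real \<Rightarrow> real"
  assumes meas: "f \<in> borel_measurable borel"
    and deriv: "\<And>t. t \<ge> 0 \<Longrightarrow> (F has_real_derivative f t) (at t)"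
    and nonneg: "\<And>t. t \<ge> 0 \<Longrightarrow> f t \<ge> 0"
    and lim: "(F \<longlongrightarrow> 0) at_top"
  shows "has_bochner_integral lborel (\<lambda>t. indicator {0<..} t * f t) (- F 0)"
proof (rule has_bochner_integral_nn_integral)
  show "(\<lambda>t. indicator {0<..} t * f t) \<in> borel_measurable lborel"
    using meas by simp
  show "AE t in lborel. 0 \<le> indicator {0<..} t * f t"
    using nonneg by (intro AE_I2) (auto simp: indicator_def)
  have "(\<integral>\<^sup>+t. ennreal (indicator {0<..} t * f t) \<partial>lborel) = (\<integral>\<^sup>+t. ennreal (f t) * indicator {0..} t \<partial>lborel)"
    by (intro nn_integral_cong_AE eventually_mono[OF AE_lborel_singleton[of 0]]) (auto simp: indicator_def)
  also have "\<dots> = ennreal (0 - F 0)"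
    by (rule nn_integral_FTC_atLeast[OF meas deriv nonneg lim])
  finally show "(\<integral>\<^sup>+t. ennreal (indicator {0<..} t * f t) \<partial>lborel) = ennreal (- F 0)"
    by simp
  have "F 0 \<le> 0"
  proof (rule tendsto_lowerbound[OF lim])
    show "\<forall>\<^sub>F t in at_top. F 0 \<le> F t"
      using eventually_ge_at_top[of 0]
    proof eventually_elim
      case (elim t)
      then show ?case
        using deriv nonneg by (intro DERIV_nonneg_imp_nondecreasing[of 0 t F]) auto
    qed
  qed simp
  then show "0 \<le> - F 0" by simp
qed

lemma has_bochner_integral_exp_minus:
  assumes "p > (0::real)"
  shows "has_bochner_integral lborel (\<lambda>t. indicator {0<..} t * exp (- p * t)) (1 / p)"
proof -
  have lim: "((\<lambda>t. - exp (- p * t) / p) \<longlongrightarrow> 0) at_top"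
    using assms by real_asymp
  have "((\<lambda>t. - exp (- p * t) / p) has_real_derivative exp (- p * t)) (at t)" for t
    using assms by (auto intro!: derivative_eq_intros)
  then show ?thesis
    using has_bochner_integral_FTC_Ioi_nonneg[of "\<lambda>t. exp (- p * t)" "\<lambda>t. - exp (- p * t) / p", OF _ _ _ lim] assms
    by auto
qed

lemma has_bochner_integral_self_mult_exp_minus:
  assumes "p > (0::real)"
  shows "has_bochner_integral lborel (\<lambda>t. indicator {0<..} t * (t * exp (- p * t))) (1 / p\<^sup>2)"
proof -
  let ?F = "\<lambda>t. - (t / p + 1 / p\<^sup>2) * exp (- p * t)"
  have lim: "(?F \<longlongrightarrow> 0) at_top"
    using assms by real_asymp
  have "(?F has_real_derivative t * exp (- p * t)) (at t)" for t
    using assms by (auto intro!: derivative_eq_intros simp: field_simps power2_eq_square)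
  then show ?thesis
    using has_bochner_integral_FTC_Ioi_nonneg[of "\<lambda>t. t * exp (- p * t)" ?F, OF _ _ _ lim] assms
    by auto
qed

lemma has_bochner_integral_exp_remainder:
  assumes r: "0 < r" "r < (p::real)"
  shows "has_bochner_integral lborel (\<lambda>t. indicator {0<..} t * (exp (- p * t) * (exp (r * t) - 1 - r * t)))
           (r\<^sup>2 / ((p - r) * p\<^sup>2))"
proof -
  define q where "q = p - r"
  have q: "q > 0" "p > 0" using r by (auto simp: q_def)
  let ?f = "\<lambda>t. exp (- p * t) * (exp (r * t) - 1 - r * t)"
  let ?F = "\<lambda>t. - exp (- q * t) / q + exp (- p * t) / p + r * ((t / p + 1 / p\<^sup>2) * exp (- p * t))"
  have "((\<lambda>t. - exp (- q * t) / q) \<longlongrightarrow> 0) at_top"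
    using q by real_asymp
  moreover have "((\<lambda>t. exp (- p * t) / p) \<longlongrightarrow> 0) at_top"
    using q by real_asymp
  moreover have "((\<lambda>t. (t / p + 1 / p\<^sup>2) * exp (- p * t)) \<longlongrightarrow> 0) at_top"
    using q by real_asymp
  ultimately have "(?F \<longlongrightarrow> 0 + 0 + r * 0) at_top"
    by (intro tendsto_intros)
  then have lim: "(?F \<longlongrightarrow> 0) at_top"
    by simp
  have der: "(?F has_real_derivative ?f t) (at t)" for t
  proof -
    have "(?F has_real_derivative
        exp (- q * t) - exp (- p * t) + r * (1 / p * exp (- p * t) + (t / p + 1 / p\<^sup>2) * (exp (- p * t) * - p))) (at t)"
      using q by (auto intro!: derivative_eq_intros)
    also have "exp (- q * t) = exp (- p * t) * exp (r * t)"
      by (simp add: q_def algebra_simps flip: exp_add)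
    also have "exp (- p * t) * exp (r * t) - exp (- p * t) + r * (1 / p * exp (- p * t) + (t / p + 1 / p\<^sup>2) * (exp (- p * t) * - p)) = ?f t"
      using q by (simp add: field_simps power2_eq_square)
    finally show ?thesis .
  qed
  have "?f t \<ge> 0" for t
    using exp_ge_add_one_self[of "r * t"] by (intro mult_nonneg_nonneg) (simp, linarith)
  then have "has_bochner_integral lborel (\<lambda>t. indicator {0<..} t * ?f t) (- ?F 0)"
    by (intro has_bochner_integral_FTC_Ioi_nonneg der lim) auto
  also have "- ?F 0 = r\<^sup>2 / (q * p\<^sup>2)"
  proof -
    have r: "r = p - q" by (simp add: q_def)
    show ?thesis
      unfolding r using q by (simp add: field_simps power2_eq_square)
  qed
  finally show ?thesis by (simp add: q_def)
qed

text \<open>Here \<open>(1-s)\<^sup>2 / ((y+s) (1+y)\<^sup>2)\<close> is the elementary transform of the previous lemma for \<open>p = 1 + y\<close> and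
\<open>r = 1 - s\<close>. For a fixed \<open>s\<close> the integrand has constant sign in \<open>t\<close>, so its absolute value is integrated by the
same formula, and \<open>|w(s)| (1-s)\<^sup>2 / s\<close> dominates the result even for \<open>y = 0\<close>.\<close>

lemma laplace_D_integrand:
  assumes ac: "a > 0" "0 \<le> c" "a + c < 3" and y: "y \<ge> 0"
  shows "has_bochner_integral lborel
           (\<lambda>t. indicator {0<..} t * (exp (- (1 + y) * t) * (LBINT s:{0<..<1}. D_integrand a c t s)))
           ((LBINT s:{0<..<1}. w_fun a c s * (1 - s)\<^sup>2 / (y + s)) / (1 + y)\<^sup>2)"
proof -
  define g where "g s t = exp (- (1 + y) * t) * (exp ((1 - s) * t) - 1 - (1 - s) * t)" for s t :: real
  define f where "f s t = indicat_real {0<..<1} s * indicat_real {0<..} t * (w_fun a c s * g s t)" for s t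
  let ?v = "\<lambda>s. (1 - s)\<^sup>2 / ((y + s) * (1 + y)\<^sup>2)"
  have g_nonneg: "g s t \<ge> 0" for s t
    unfolding g_def using exp_ge_add_one_self[of "(1 - s) * t"] by (intro mult_nonneg_nonneg) (simp, linarith)
  have g: "has_bochner_integral lborel (\<lambda>t. indicator {0<..} t * g s t) (?v s)" if "0 < s" "s < 1" for s
    using has_bochner_integral_exp_remainder[of "1 - s" "1 + y"] that y by (simp add: g_def add.commute)
  have meas: "(\<lambda>(s, t). f s t) \<in> borel_measurable (lborel \<Otimes>\<^sub>M lborel)"
    unfolding f_def g_def by measurable
  have fs: "has_bochner_integral lborel (f s) (indicator {0<..<1} s * (w_fun a c s * ?v s))" for s
  proof (cases "s \<in> {0<..<1}")
    case True
    then have "has_bochner_integral lborel (\<lambda>t. w_fun a c s * (indicator {0<..} t * g s t)) (w_fun a c s * ?v s)"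
      using g[of s] by (intro has_bochner_integral_mult_right) auto
    then show ?thesis
      using True by (simp add: f_def[abs_def] mult_ac)
  qed (simp add: f_def[abs_def] has_bochner_integral_zero)
  have fs_abs: "has_bochner_integral lborel (\<lambda>t. norm (f s t)) (indicator {0<..<1} s * (\<bar>w_fun a c s\<bar> * ?v s))" for s
  proof (cases "s \<in> {0<..<1}")
    case True
    then have "has_bochner_integral lborel (\<lambda>t. \<bar>w_fun a c s\<bar> * (indicator {0<..} t * g s t)) (\<bar>w_fun a c s\<bar> * ?v s)"
      using g[of s] by (intro has_bochner_integral_mult_right) auto
    then show ?thesis
      using True g_nonneg by (simp add: f_def[abs_def] abs_mult mult_ac)
  qed (simp add: f_def[abs_def] has_bochner_integral_zero)
  have int: "integrable (lborel \<Otimes>\<^sub>M lborel) (\<lambda>(s, t). f s t)"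
  proof (rule lborel_pair.Fubini_integrable[OF meas])
    have "set_integrable lborel {0<..<1} (\<lambda>s. \<bar>w_fun a c s\<bar> * ?v s)"
    proof (rule set_integrable_bound[OF integrable_w_fun_weighted[OF ac]])
      show "set_borel_measurable lborel {0<..<1} (\<lambda>s. \<bar>w_fun a c s\<bar> * ?v s)"
        unfolding set_borel_measurable_def by measurable
      have "\<bar>w_fun a c s\<bar> * ?v s \<le> \<bar>w_fun a c s\<bar> * (1 - s)\<^sup>2 / s" if s: "0 < s" "s < 1" for s
      proof -
        have "s * 1 \<le> (y + s) * (1 + y)\<^sup>2"
          using s y by (intro mult_mono) (auto simp: one_le_power)
        then have "?v s \<le> (1 - s)\<^sup>2 / s"
          using s y by (intro divide_left_mono) auto
        from mult_left_mono[OF this, of "\<bar>w_fun a c s\<bar>"] show ?thesis by simp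
      qed
      then show "AE s in lborel. s \<in> {0<..<1} \<longrightarrow> norm (\<bar>w_fun a c s\<bar> * ?v s) \<le> norm (\<bar>w_fun a c s\<bar> * (1 - s)\<^sup>2 / s)"
        using y by (intro AE_I2) (auto simp: abs_mult)
    qed
    then show "integrable lborel (\<lambda>s. \<integral>t. norm (case (s, t) of (s, t) \<Rightarrow> f s t) \<partial>lborel)"
      using has_bochner_integral_integral_eq[OF fs_abs] by (simp add: set_integrable_def)
    show "AE s in lborel. integrable lborel (\<lambda>t. case (s, t) of (s, t) \<Rightarrow> f s t)"
      using fs by (simp add: has_bochner_integral_iff)
  qed
  have inner: "(\<integral>s. f s t \<partial>lborel) = indicator {0<..} t * (exp (- (1 + y) * t) * (LBINT s:{0<..<1}. D_integrand a c t s))" for t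
  proof -
    have "f s t = indicator {0<..} t * exp (- (1 + y) * t) * (indicator {0<..<1} s *\<^sub>R D_integrand a c t s)" for s
      by (simp add: f_def g_def D_integrand_def mult_ac)
    then show ?thesis
      by (simp add: set_lebesgue_integral_def)
  qed
  have "integrable lborel (\<lambda>t. \<integral>s. f s t \<partial>lborel)"
    using lborel_pair.integrable_snd[OF int] .
  moreover have "(\<integral>t. (\<integral>s. f s t \<partial>lborel) \<partial>lborel) = (\<integral>s. (\<integral>t. f s t \<partial>lborel) \<partial>lborel)"
    using lborel_pair.Fubini_integral[OF int] .
  moreover have "(\<integral>s. (\<integral>t. f s t \<partial>lborel) \<partial>lborel) = (LBINT s:{0<..<1}. w_fun a c s * (1 - s)\<^sup>2 / (y + s)) / (1 + y)\<^sup>2"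
  proof -
    have "(\<integral>t. f s t \<partial>lborel) = indicator {0<..<1} s *\<^sub>R (w_fun a c s * (1 - s)\<^sup>2 / (y + s)) / (1 + y)\<^sup>2" for s
      using has_bochner_integral_integral_eq[OF fs[of s]] by simp
    then show ?thesis
      unfolding set_lebesgue_integral_def by (simp only: integral_divide_zero)
  qed
  ultimately show ?thesis
    unfolding inner has_bochner_integral_iff by simp
qed

lemma laplace_Phi_fun:
  assumes ac: "a > 0" "0 \<le> c" "a + c < 3" and y: "y \<ge> 0"
  shows "has_bochner_integral lborel (\<lambda>t. indicator {0<..} t * (exp (- y * t) * Phi_fun a c t))
    ((exp a * (q1 a c * (1 + y) + (q1 a c - q2 a c)) + (LBINT s:{0<..<1}. w_fun a c s * (1 - s)\<^sup>2 / (y + s))) / (1 + y)\<^sup>2)"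
proof -
  let ?e = "\<lambda>t. exp (- (1 + y) * t)" and ?I = "indicat_real {0<..}"
  let ?W = "\<lambda>t. LBINT s:{0<..<1}. D_integrand a c t s"
  let ?J = "LBINT s:{0<..<1}. w_fun a c s * (1 - s)\<^sup>2 / (y + s)"
  have "has_bochner_integral lborel
      (\<lambda>t. exp a * q1 a c * (?I t * ?e t) + exp a * (q1 a c - q2 a c) * (?I t * (t * ?e t)) + ?I t * (?e t * ?W t))
      (exp a * q1 a c * (1 / (1 + y)) + exp a * (q1 a c - q2 a c) * (1 / (1 + y)\<^sup>2) + ?J / (1 + y)\<^sup>2)"
    using y by (intro has_bochner_integral_add has_bochner_integral_mult_right has_bochner_integral_exp_minus
        has_bochner_integral_self_mult_exp_minus laplace_D_integrand ac) auto
  also have "(\<lambda>t. exp a * q1 a c * (?I t * ?e t) + exp a * (q1 a c - q2 a c) * (?I t * (t * ?e t)) + ?I t * (?e t * ?W t))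
      = (\<lambda>t. ?I t * (exp (- y * t) * Phi_fun a c t))"
  proof
    fix t :: real
    have "exp (- y * t) * exp (a - t) = exp a * ?e t"
      by (simp add: algebra_simps flip: exp_add)
    then have "exp (- y * t) * Phi_fun a c t = exp a * ?e t * D_fun a c t"
      by (simp add: Phi_fun_def mult.assoc[symmetric])
    also have "\<dots> = exp a * q1 a c * ?e t + exp a * (q1 a c - q2 a c) * (t * ?e t) + (exp a * exp (- a)) * (?e t * ?W t)"
      by (simp add: D_fun_def algebra_simps)
    also have "exp a * exp (- a) = 1"
      by (simp flip: exp_add)
    finally show "exp a * q1 a c * (?I t * ?e t) + exp a * (q1 a c - q2 a c) * (?I t * (t * ?e t)) + ?I t * (?e t * ?W t)
        = ?I t * (exp (- y * t) * Phi_fun a c t)"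
      by (cases "t > 0") (simp_all add: mult.commute)
  qed
  also have "exp a * q1 a c * (1 / (1 + y)) + exp a * (q1 a c - q2 a c) * (1 / (1 + y)\<^sup>2) + ?J / (1 + y)\<^sup>2
      = (exp a * (q1 a c * (1 + y) + (q1 a c - q2 a c)) + ?J) / (1 + y)\<^sup>2"
    using y by (simp add: divide_simps) (simp add: power2_eq_square algebra_simps)
  finally show ?thesis .
qed

section \<open>Residues in the strip\<close>

lemma contour_integral_linepath_horizontal:
  assumes "u < v"
  shows "contour_integral (linepath (Complex u d) (Complex v d)) f = integral {u..v} (\<lambda>x. f (Complex x d))"
proof -
  let ?p = "Complex u d" and ?q = "Complex v d"
  have "contour_integral (linepath ?p ?q) f = (?q - ?p) * integral {0..1} (\<lambda>x. f (linepath ?p ?q x))"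
    by (simp add: contour_integral_integral)
  also have "?q - ?p = of_real (v - u)"
    by (simp add: complex_eq_iff)
  also have "integral {0..1} (\<lambda>x. f (linepath ?p ?q x)) = integral {0..1} (\<lambda>x. f (Complex (u + (v - u) * x) d))"
  proof (rule integral_cong)
    fix x :: real
    have "linepath ?p ?q x = Complex (u + (v - u) * x) d"
      by (simp add: linepath_def complex_eq_iff algebra_simps)
    then show "f (linepath ?p ?q x) = f (Complex (u + (v - u) * x) d)" by simp
  qed
  also have "{0..1} = (\<lambda>x. x / (v - u)) ` {0..v - u}"
    using assms by simp
  also have "integral \<dots> (\<lambda>x. f (Complex (u + (v - u) * x) d)) =
             integral {u-u..v-u} (\<lambda>x. f (Complex (x + u) d)) / of_real (v - u)"
    using assms by (subst integral_stretch_real) (auto simp: scaleR_conv_of_real add_ac)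
  also have "\<dots> = integral {u..v} (\<lambda>x. f (Complex x d)) / of_real (v - u)"
    by (subst integral_shift_real_ivl) (rule refl)
  finally show ?thesis
    using assms by simp
qed

text \<open>The Taylor coefficient of a holomorphic function is determined by the behaviour along the positive real
axis. This reduces the residue of order three at \<open>0\<close> to a real limit.\<close>

lemma second_taylor_coeff_eq_real_limit:
  fixes f :: "complex \<Rightarrow> complex"
  assumes A: "open A" "0 \<in> A" and f: "f holomorphic_on A"
    and lim: "((\<lambda>x::real. (f (of_real x) - c0 - c1 * of_real x) / of_real x ^ 2) \<longlongrightarrow> c2) (at_right 0)"
  shows "(deriv ^^ 2) f 0 / 2 = c2"
proof -
  obtain r where r: "r > 0" "cball 0 r \<subseteq> A"
    using A by (auto simp: open_contains_cball)
  define d where "d n = (deriv ^^ n) f" for n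
  have hol: "d n holomorphic_on A" for n
    unfolding d_def using f A by (intro holomorphic_higher_deriv)
  have der: "(d n has_field_derivative d (Suc n) z) (at z)" if "z \<in> A" for n z
    using holomorphic_derivI[OF hol[of n] A(1) that] by (simp add: d_def)
  have "continuous_on (cball 0 r) (d 3)"
    using hol[of 3] r holomorphic_on_imp_continuous_on continuous_on_subset by blast
  then obtain B where B: "\<And>z. z \<in> cball 0 r \<Longrightarrow> norm (d 3 z) \<le> B"
    by (metis compact_cball compact_continuous_image compact_imp_bounded bounded_iff imageI)
  define q where "q x = f (of_real x) - (d 0 0 + d 1 0 * of_real x + d 2 0 / 2 * of_real x ^ 2)" for x :: real
  have q: "norm (q x / of_real x ^ 2) \<le> B / 2 * x" if "0 < x" "x < r" for x
  proof -
    have "norm (d 0 (of_real x) - (\<Sum>i\<le>2. d i 0 * (of_real x - 0) ^ i / fact i)) \<le> B * norm (complex_of_real x - 0) ^ Suc 2 / fact 2"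
    proof (rule complex_Taylor[of "cball 0 r"])
      show "(d i has_field_derivative d (Suc i) z) (at z within cball 0 r)" if "z \<in> cball 0 r" for i z
        using der that r by (blast intro: has_field_derivative_at_within)
    qed (use B r that in \<open>auto simp: numeral_3_eq_3 numeral_2_eq_2\<close>)
    also have "d 0 (of_real x) - (\<Sum>i\<le>2. d i 0 * (of_real x - 0) ^ i / fact i) = q x"
      by (simp add: q_def d_def numeral_2_eq_2)
    finally have "norm (q x) \<le> B * x ^ 3 / 2"
      using that by (simp add: numeral_3_eq_3)
    then show ?thesis
      using that by (simp add: norm_divide norm_mult norm_power divide_le_eq power2_eq_square power3_eq_cube mult_ac)
  qed
  have q0: "((\<lambda>x. q x / of_real x ^ 2) \<longlongrightarrow> 0) (at_right 0)"
  proof (rule Lim_null_comparison)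
    show "\<forall>\<^sub>F x in at_right 0. norm (q x / of_real x ^ 2) \<le> B / 2 * x"
      using q r by (auto simp: eventually_at_right_field)
    show "((\<lambda>x::real. B / 2 * x) \<longlongrightarrow> 0) (at_right 0)"
      by (auto intro!: tendsto_eq_intros)
  qed
  define L where "L = c2 - d 2 0 / 2"
  define e0 where "e0 = d 0 0 - c0"
  define e1 where "e1 = d 1 0 - c1"
  have "((\<lambda>x. (f (of_real x) - c0 - c1 * of_real x) / of_real x ^ 2 - q x / of_real x ^ 2 - d 2 0 / 2) \<longlongrightarrow> c2 - 0 - d 2 0 / 2) (at_right 0)"
    by (intro tendsto_intros lim q0)
  moreover have "\<forall>\<^sub>F x in at_right 0. (f (of_real x) - c0 - c1 * of_real x) / of_real x ^ 2 - q x / of_real x ^ 2 - d 2 0 / 2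
      = (e0 + e1 * of_real x) / of_real x ^ 2"
    using eventually_at_right_less[of 0] by eventually_elim (simp add: q_def e0_def e1_def field_simps)
  ultimately have L: "((\<lambda>x::real. (e0 + e1 * of_real x) / of_real x ^ 2) \<longlongrightarrow> L) (at_right 0)"
    unfolding L_def by (simp add: filterlim_cong)
  have x0: "((\<lambda>x::real. complex_of_real x) \<longlongrightarrow> 0) (at_right 0)"
    by (auto intro!: tendsto_eq_intros)
  have "((\<lambda>x::real. (e0 + e1 * of_real x) / of_real x ^ 2 * of_real x ^ 2) \<longlongrightarrow> L * 0 ^ 2) (at_right 0)"
    by (intro tendsto_intros L x0)
  moreover have "\<forall>\<^sub>F x in at_right 0. (e0 + e1 * of_real x) / of_real x ^ 2 * of_real x ^ 2 = e0 + e1 * of_real x"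
    using eventually_at_right_less[of 0] by eventually_elim simp
  ultimately have "((\<lambda>x::real. e0 + e1 * of_real x) \<longlongrightarrow> 0) (at_right 0)"
    by (simp add: filterlim_cong)
  moreover have "((\<lambda>x::real. e0 + e1 * of_real x) \<longlongrightarrow> e0 + e1 * 0) (at_right 0)"
    by (intro tendsto_intros x0)
  ultimately have "0 = e0 + e1 * 0"
    by (intro tendsto_unique[OF trivial_limit_at_right_real])
  then have e0: "e0 = 0" by simp
  have "((\<lambda>x::real. (e0 + e1 * of_real x) / of_real x ^ 2 * of_real x) \<longlongrightarrow> L * 0) (at_right 0)"
    by (intro tendsto_intros L x0)
  moreover have "\<forall>\<^sub>F x in at_right 0. (e0 + e1 * of_real x) / of_real x ^ 2 * of_real x = e1"
    using eventually_at_right_less[of 0] by eventually_elim (simp add: e0 power2_eq_square)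
  ultimately have "((\<lambda>x::real. e1) \<longlongrightarrow> 0) (at_right 0)"
    by (simp add: filterlim_cong)
  then have "e1 = 0"
    by (simp add: tendsto_const_iff)
  then have "L = 0"
    using L e0 by (simp add: tendsto_const_iff)
  then show ?thesis
    by (simp add: L_def d_def)
qed

definition exp_quot :: "complex \<Rightarrow> complex" where
  "exp_quot z = (if z = 0 then 1 else (exp z - 1) / z)"

lemma holomorphic_exp_quot: "exp_quot holomorphic_on UNIV"
proof (rule no_isolated_singularity'[of "{0}"])
  have "((\<lambda>h::complex. (exp (0 + h) - exp 0) / h) \<longlongrightarrow> exp 0) (at 0)"
    using DERIV_exp[of "0::complex"] by (simp only: DERIV_def)
  then have "((\<lambda>z::complex. (exp z - 1) / z) \<longlongrightarrow> 1) (at 0)"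
    by simp
  moreover have "\<forall>\<^sub>F z in at 0. (exp z - 1) / z = exp_quot z"
    by (auto simp: eventually_at exp_quot_def intro: exI[of _ 1])
  ultimately have "(exp_quot \<longlongrightarrow> 1) (at 0)"
    by (rule Lim_transform_eventually)
  then show "(exp_quot \<longlongrightarrow> exp_quot z) (at z within UNIV)" if "z \<in> {0}" for z
    using that by (simp add: exp_quot_def)
  have "(\<lambda>z. (exp z - 1) / z) holomorphic_on UNIV - {0}"
    by (intro holomorphic_intros) auto
  then show "exp_quot holomorphic_on UNIV - {0}"
    by (rule holomorphic_transform) (auto simp: exp_quot_def)
qed auto

text \<open>Only \<open>|Im \<zeta>| \<le> \<pi>\<close> is needed for the contour; the larger strip is an open neighbourhood of it on which \<open>exp\<close>
still takes each positive real value only on the real axis.\<close>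

definition strip :: "complex set" where
  "strip = {z. \<bar>Im z\<bar> < 2 * pi}"

lemma open_strip: "open strip"
  unfolding strip_def by (intro open_Collect_less continuous_intros)

lemma connected_strip: "connected strip"
proof (rule convex_connected)
  have *: "strip = {z. Im z < 2 * pi} \<inter> {z. Im z > - (2 * pi)}"
    by (auto simp: strip_def)
  show "convex strip"
    unfolding * by (intro convex_Int convex_halfspace_Im_lt convex_halfspace_Im_gt)
qed

lemma exp_eq_exp_of_real_strip:
  assumes z: "z \<in> strip" and e: "exp z = exp (of_real u)"
  shows "z = of_real u"
proof -
  obtain n :: int where n: "z = of_real u + of_int (2 * n) * pi * \<i>"
    using e by (auto simp: exp_eq)
  then have "\<bar>of_int n\<bar> * (2 * pi) < 1 * (2 * pi)"
    using z by (simp add: strip_def abs_mult)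
  then have "\<bar>of_int n\<bar> < (1::real)"
    by (simp only: mult_less_cancel_right) simp
  then show ?thesis using n by simp
qed

text \<open>The differential form \<open>(1+z)\<^sup>2 H(z) / (z - y) dz\<close> in the coordinate \<open>\<zeta>\<close> with \<open>z = 1 / (exp \<zeta> - 1)\<close>: then
\<open>H = exp ((a z - c) \<zeta>)\<close>, \<open>1 + z = exp \<zeta> / (exp \<zeta> - 1)\<close> and \<open>dz = - exp \<zeta> / (exp \<zeta> - 1)\<^sup>2 d\<zeta>\<close>. In the definition and
the lemmas below the letter \<open>z\<close> stands for \<open>\<zeta>\<close>.\<close>

definition strip_integrand :: "real \<Rightarrow> real \<Rightarrow> real \<Rightarrow> complex \<Rightarrow> complex" where
  "strip_integrand a c y z = exp (a * z / (exp z - 1) - c * z) * exp (3 * z) / ((exp z - 1) ^ 3 * (y * (exp z - 1) - 1))"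

lemma ln_one_plus_inverse_pos: "y > 0 \<Longrightarrow> ln (1 + 1 / y) > (0::real)"
  by (rule ln_gt_zero) simp

lemma exp_eq_1_strip: "z \<in> strip \<Longrightarrow> exp z = 1 \<Longrightarrow> z = 0"
  using exp_eq_exp_of_real_strip[of z 0] by simp

lemma strip_pole_eq:
  assumes "y > 0" "z \<in> strip" "of_real y * (exp z - 1) = 1"
  shows "z = of_real (ln (1 + 1 / y))"
proof (rule exp_eq_exp_of_real_strip[OF assms(2)])
  have "exp z = of_real (1 + 1 / y)"
    using assms by (simp add: field_simps)
  then show "exp z = exp (of_real (ln (1 + 1 / y)))"
    using assms by (simp add: exp_of_real add_pos_pos del: of_real_add)
qed

lemma holomorphic_strip_integrand:
  assumes "y > 0"
  shows "strip_integrand a c y holomorphic_on strip - {0, of_real (ln (1 + 1 / y))}"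
  unfolding strip_integrand_def[abs_def]
  using assms exp_eq_1_strip strip_pole_eq
  by (intro holomorphic_intros) auto

text \<open>This residue is the contribution of the point at infinity in the original coordinate. Up to the sign it
is the polynomial part of \<open>(1+z)\<^sup>2 H(z)\<close>, evaluated at \<open>y\<close>; the constants \<open>q\<^sub>1\<close> and \<open>q\<^sub>2\<close> enter through
\<open>H(z) = e\<^sup>a (1 - q\<^sub>1/z + q\<^sub>2/z\<^sup>2 - \<dots>)\<close>.\<close>

lemma residue_strip_integrand_0:
  assumes y: "y > 0"
  shows "residue (strip_integrand a c y) 0 = of_real (- exp a * ((1 + y)\<^sup>2 - q1 a c * (1 + y) - (q1 a c - q2 a c)))"
proof -
  define z0 where "z0 = complex_of_real (ln (1 + 1 / y))"
  define A where "A = strip - {z0}"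
  define N where "N z = exp (a / exp_quot z - c * z) * exp (3 * z) / (exp_quot z ^ 3 * (y * (exp z - 1) - 1))" for z :: complex
  \<comment> \<open>\<open>N\<close> is the integrand without its pole \<open>z\<^sup>-\<^sup>3\<close>, so the residue is half its second derivative at \<open>0\<close>.\<close>
  have z0: "z0 \<noteq> 0"
    using ln_one_plus_inverse_pos[OF y] by (simp add: z0_def)
  have A: "open A" "0 \<in> A"
    using z0 open_strip by (auto simp: A_def strip_def)
  have nz: "exp_quot z \<noteq> 0" "of_real y * (exp z - 1) - 1 \<noteq> 0" if "z \<in> A" for z
    using that exp_eq_1_strip[of z] strip_pole_eq[OF y, of z]
    by (auto simp: A_def exp_quot_def z0_def)
  have holN: "N holomorphic_on A"
    unfolding N_def[abs_def] using nz
    by (intro holomorphic_intros holomorphic_on_subset[OF holomorphic_exp_quot]) auto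
  have FN: "strip_integrand a c y z = N z / z ^ Suc 2" if "z \<noteq> 0" for z
    using that by (simp add: strip_integrand_def N_def exp_quot_def power_divide numeral_3_eq_3)
  have "residue (strip_integrand a c y) 0 = residue (\<lambda>z. N z / z ^ Suc 2) 0"
    by (rule residue_cong) (auto simp: eventually_at FN intro: exI[of _ 1])
  also have "\<dots> = (deriv ^^ 2) N 0 / 2"
    using residue_holomorphic_over_power'[OF A holN, of 2] by (simp add: numeral_2_eq_2)
  also have "\<dots> = of_real (- exp a * ((1 + y)\<^sup>2 - q1 a c * (1 + y) - (q1 a c - q2 a c)))"
  proof (rule second_taylor_coeff_eq_real_limit[OF A holN])
    define Nr where "Nr x = exp (a * (x / (exp x - 1)) - c * x) * exp (3 * x) / (((exp x - 1) / x) ^ 3 * (y * (exp x - 1) - 1))" for x :: real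
    \<comment> \<open>The Taylor coefficients of \<open>N\<close> of order zero, one and two.\<close>
    let ?c0 = "- exp a" and ?c1 = "- exp a * (3 / 2 + y - q1 a c)"
    let ?c2 = "- exp a * ((1 + y)\<^sup>2 - q1 a c * (1 + y) - (q1 a c - q2 a c))"
    have "((\<lambda>x. (Nr x - ?c0 - ?c1 * x) / x ^ 2) \<longlongrightarrow> ?c2) (at_right 0)"
      unfolding Nr_def q1_def q2_def by (real_asymp simp: field_simps power2_eq_square)
    then have "((\<lambda>x. complex_of_real ((Nr x - ?c0 - ?c1 * x) / x ^ 2)) \<longlongrightarrow> of_real ?c2) (at_right 0)"
      by (rule tendsto_of_real)
    moreover have "\<forall>\<^sub>F x in at_right 0. complex_of_real ((Nr x - ?c0 - ?c1 * x) / x ^ 2)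
        = (N (of_real x) - of_real ?c0 - of_real ?c1 * of_real x) / of_real x ^ 2"
      using eventually_at_right_less[of 0]
    proof eventually_elim
      case (elim x)
      have "N (of_real x) = of_real (Nr x)"
        using elim by (simp add: N_def Nr_def exp_quot_def flip: exp_of_real)
      then show ?case by simp
    qed
    ultimately show "((\<lambda>x. (N (of_real x) - of_real ?c0 - of_real ?c1 * of_real x) / of_real x ^ 2) \<longlongrightarrow> of_real ?c2) (at_right 0)"
      by (rule Lim_transform_eventually)
  qed
  finally show ?thesis .
qed

lemma residue_strip_integrand_pole:
  assumes y: "y > 0"
  shows "residue (strip_integrand a c y) (of_real (ln (1 + 1 / y))) = of_real (H_fun a c y * (1 + y)\<^sup>2)"
proof -
  define l where "l = ln (1 + 1 / y)"
  define z0 where "z0 = complex_of_real l"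
  define f where "f z = exp (a * z / (exp z - 1) - c * z) * exp (3 * z) / (exp z - 1) ^ 3" for z :: complex
  define g where "g z = of_real y * (exp z - 1) - 1" for z :: complex
  have el: "exp l = 1 + 1 / y"
    unfolding l_def using y by (simp add: add_pos_pos)
  have ez: "exp z0 = of_real (1 + 1 / y)"
    by (simp only: z0_def exp_of_real el)
  have z0: "z0 \<in> strip - {0}"
    using ln_one_plus_inverse_pos[OF y] by (auto simp: z0_def strip_def l_def)
  have "residue (\<lambda>z. f z / g z) z0 = f z0 / (of_real y * exp z0)"
  proof (rule residue_simple_pole_deriv)
    show "open (strip - {0})"
      using open_strip by auto
    show "connected (strip - {0})"
      using connected_open_delete[OF open_strip connected_strip] by simp
    show "f holomorphic_on strip - {0}"
      unfolding f_def[abs_def] using exp_eq_1_strip by (intro holomorphic_intros) auto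
    show "g holomorphic_on strip - {0}"
      unfolding g_def[abs_def] by (intro holomorphic_intros)
    show "f z0 \<noteq> 0"
      using y by (simp add: f_def ez)
    show "g z0 = 0"
      using y by (simp add: g_def ez)
    show "(g has_field_derivative of_real y * exp z0) (at z0)"
      unfolding g_def[abs_def] by (auto intro!: derivative_eq_intros)
    show "of_real y * exp z0 \<noteq> 0"
      using y by simp
  qed (use z0 in auto)
  also have "(\<lambda>z. f z / g z) = strip_integrand a c y"
    by (simp add: f_def g_def strip_integrand_def fun_eq_iff)
  also have "f z0 / (of_real y * exp z0) = of_real (exp (a * l / (exp l - 1) - c * l) * exp l ^ 3 / (exp l - 1) ^ 3 / (y * exp l))"
    by (simp add: f_def z0_def exp_of_real flip: exp_of_nat_mult)
       (simp add: exp_of_real flip: exp_of_real)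
  also have "exp (a * l / (exp l - 1) - c * l) * exp l ^ 3 / (exp l - 1) ^ 3 / (y * exp l) = H_fun a c y * (1 + y)\<^sup>2"
  proof -
    have pos: "1 + 1 / y \<noteq> 0"
      using y by (simp add: add_nonneg_eq_0_iff)
    have "H_fun a c y = exp (a * l / (exp l - 1) - c * l)"
      using y pos by (simp add: H_fun_def powr_def el algebra_simps flip: l_def)
    moreover have "exp l ^ 3 / (exp l - 1) ^ 3 / (y * exp l) = (1 + y)\<^sup>2"
    proof -
      have e1: "exp l - 1 = 1 / y" and e2: "exp l = (1 + y) / y"
        unfolding el using y by (simp_all add: field_simps)
      show ?thesis
        unfolding e1 unfolding e2 using y
        by (simp add: power_divide power2_eq_square power3_eq_cube)
    qed
    ultimately show ?thesis
      by (simp only: times_divide_eq_right[symmetric])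
  qed
  finally show ?thesis by (simp add: z0_def l_def)
qed

section \<open>The integral representation of H\<close>

text \<open>On the upper edge \<open>\<zeta> = x + i\<pi>\<close> the original coordinate is \<open>z = 1 / (exp \<zeta> - 1) = -s\<close> with \<open>s\<close> as
defined here.\<close>

definition cut_point :: "real \<Rightarrow> real" where
  "cut_point x = 1 / (1 + exp x)"

lemma cut_point_bounds: "0 < cut_point x" "cut_point x < 1"
  by (simp_all add: cut_point_def add_pos_pos)

lemma exp_conv_cut_point: "exp x = (1 - cut_point x) / cut_point x"
  by (simp add: cut_point_def add_pos_pos field_simps add_nonneg_eq_0_iff)

lemma has_field_derivative_cut_point: "(cut_point has_field_derivative - (cut_point x * (1 - cut_point x))) (at x within A)"
proof -
  have nz: "1 + exp x \<noteq> 0"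
    by (simp add: add_nonneg_eq_0_iff)
  show ?thesis
    unfolding cut_point_def[abs_def] using nz
    by (auto intro!: derivative_eq_intros simp: divide_simps power2_eq_square)
qed

lemma inj_cut_point: "inj cut_point"
  by (auto simp: inj_def cut_point_def)

lemma range_cut_point: "range cut_point = {0<..<1}"
proof (intro equalityI subsetI)
  fix s :: real
  assume "s \<in> {0<..<1}"
  then have "s = cut_point (ln ((1 - s) / s))"
    by (simp add: cut_point_def field_simps)
  then show "s \<in> range cut_point" by blast
qed (use cut_point_bounds in auto)

text \<open>The weight \<open>w\<close> is the boundary value: on the upper edge \<open>H\<close> becomes \<open>exp (-(a s + c) \<zeta>)\<close>, of modulus
\<open>(s/(1-s))\<close> to the power \<open>a s + c\<close> and argument \<open>-\<pi>(a s + c)\<close>. The factor \<open>s (1-s)\<close> is the Jacobian of \<open>x \<mapsto> s\<close>.\<close>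

lemma Im_strip_integrand_upper:
  assumes y: "y > 0"
  shows "Im (strip_integrand a c y (Complex x pi)) =
    pi * (cut_point x * (1 - cut_point x) * (w_fun a c (cut_point x) * (1 - cut_point x)\<^sup>2 / (y + cut_point x)))"
proof -
  define z where "z = Complex x pi"
  define s where "s = cut_point x"
  have s: "0 < s" "s < 1"
    using cut_point_bounds by (auto simp: s_def)
  have ex: "exp x = (1 - s) / s"
    by (simp add: s_def exp_conv_cut_point)
  have ez: "exp z = - of_real ((1 - s) / s)"
    unfolding z_def exp_eq_polar by (simp add: ex)
  have ez1: "exp z - 1 = - of_real (1 / s)"
    unfolding ez using s by (simp add: field_simps)
  have ez2: "of_real y * (exp z - 1) - 1 = - of_real ((y + s) / s)"
    unfolding ez1 using s by (simp add: field_simps)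
  have e3: "exp (3 * z) = (exp z) ^ 3"
    by (simp flip: exp_of_nat_mult)
  have e4: "of_real a * z / (exp z - 1) - of_real c * z = of_real (- (a * s + c)) * z"
    unfolding ez1 using s by (simp add: field_simps)
  define r where "r = ((1 - s) / s) ^ 3 / ((1 / s) ^ 3 * ((y + s) / s))"
  have "strip_integrand a c y z = exp (of_real (- (a * s + c)) * z) * of_real (- r)"
    unfolding strip_integrand_def e4 ez2 e3 unfolding ez1 unfolding ez r_def by simp
  then have "Im (strip_integrand a c y z) = exp (- (a * s + c) * x) * sin (- (pi * (a * s + c))) * - r"
    by (simp add: Im_exp z_def mult.commute[of pi] del: of_real_minus of_real_mult of_real_add minus_add_distrib sin_minus)
  then have "Im (strip_integrand a c y z) = exp (- (a * s + c) * x) * sin (pi * (a * s + c)) * r"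
    by (simp only: sin_minus mult_minus_left mult_minus_right minus_minus)
  also have "exp (- (a * s + c) * x) = (s / (1 - s)) powr (a * s + c)"
  proof -
    have "s / (1 - s) = exp (- x)"
      unfolding exp_minus ex by simp
    then show ?thesis
      by (simp add: powr_def algebra_simps)
  qed
  also have "r = s * (1 - s) * ((1 - s)\<^sup>2 / (y + s))"
    unfolding r_def using s y by (simp add: power_divide power2_eq_square power3_eq_cube)
  finally show ?thesis
    by (simp add: w_fun_def z_def s_def)
qed

lemma strip_integrand_cnj: "strip_integrand a c y (cnj z) = cnj (strip_integrand a c y z)"
  by (simp add: strip_integrand_def exp_cnj)

lemma has_integral_Im_strip_integrand_upper:
  assumes "a > 0" "0 \<le> c" "a + c < 3" and y: "y > 0"
  shows "((\<lambda>x. Im (strip_integrand a c y (Complex x pi))) has_integral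
           pi * (LBINT s:{0<..<1}. w_fun a c s * (1 - s)\<^sup>2 / (y + s))) UNIV"
proof -
  let ?f = "\<lambda>s. w_fun a c s * (1 - s)\<^sup>2 / (y + s)"
  have f: "set_integrable lborel {0<..<1} ?f"
  proof (rule set_integrable_bound)
    show "set_integrable lborel {0<..<1} (\<lambda>s. \<bar>w_fun a c s\<bar> * (1 - s)\<^sup>2 / y)"
      using integrable_w_fun_square[OF assms(1-3)] by simp
    show "set_borel_measurable lborel {0<..<1} ?f"
      unfolding set_borel_measurable_def by measurable
    show "AE s in lborel. s \<in> {0<..<1} \<longrightarrow> norm (?f s) \<le> norm (\<bar>w_fun a c s\<bar> * (1 - s)\<^sup>2 / y)"
      using y by (intro AE_I2) (auto simp: abs_mult intro!: divide_left_mono)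
  qed
  have abs_f: "?f absolutely_integrable_on range cut_point"
    unfolding range_cut_point using f unfolding set_integrable_def
    by (subst integrable_completion) (auto simp: borel_measurable_integrable)
  have int_f: "integral (range cut_point) ?f = (LBINT s:{0<..<1}. ?f s)"
    unfolding range_cut_point using set_borel_integral_eq_integral(2)[OF f] by simp
  have "(\<lambda>x. \<bar>- (cut_point x * (1 - cut_point x))\<bar> * ?f (cut_point x)) absolutely_integrable_on UNIV \<and>
        integral UNIV (\<lambda>x. \<bar>- (cut_point x * (1 - cut_point x))\<bar> * ?f (cut_point x)) = (LBINT s:{0<..<1}. ?f s)"
    using has_absolute_integral_change_of_variables_1'[of UNIV cut_point "\<lambda>x. - (cut_point x * (1 - cut_point x))" ?f
        "LBINT s:{0<..<1}. ?f s"] abs_f int_f inj_cut_point has_field_derivative_cut_point by simp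
  moreover have "\<bar>- (cut_point x * (1 - cut_point x))\<bar> = cut_point x * (1 - cut_point x)" for x
    using cut_point_bounds[of x] by (simp add: abs_mult)
  ultimately have "((\<lambda>x. cut_point x * (1 - cut_point x) * ?f (cut_point x)) has_integral (LBINT s:{0<..<1}. ?f s)) UNIV"
    by (auto simp: has_integral_iff intro: set_lebesgue_integral_eq_integral)
  from has_integral_mult_right[OF this, of pi] show ?thesis
    by (simp add: Im_strip_integrand_upper[OF y])
qed

text \<open>The right edge is near \<open>z = 0\<close>. There \<open>a \<zeta> / (exp \<zeta> - 1)\<close> tends to \<open>0\<close> and the bound decays like \<open>exp (-R)\<close>.\<close>

lemma strip_integrand_right_bound:
  assumes y: "y > 0" and ac: "a > 0" "0 \<le> c" and R: "R > 0" "y * (exp R - 1) > 1"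
    and z: "Re z = R" "\<bar>Im z\<bar> \<le> pi"
  shows "norm (strip_integrand a c y z) \<le> exp (a * (R + pi) / (exp R - 1)) * exp (3 * R) / ((exp R - 1) ^ 3 * (y * (exp R - 1) - 1))"
proof -
  have e1: "exp R - 1 > 0" using R by simp
  have nE: "exp R - 1 \<le> norm (exp z - 1)"
    using norm_triangle_ineq2[of "exp z" 1] z by simp
  have nz: "norm z \<le> R + pi"
    using cmod_le[of z] z R by simp
  have n2: "y * (exp R - 1) - 1 \<le> norm (of_real y * (exp z - 1) - 1)"
  proof -
    have "y * (exp R - 1) - 1 \<le> norm (of_real y * (exp z - 1)) - norm (1::complex)"
      using nE y by (simp add: norm_mult)
    also have "\<dots> \<le> norm (of_real y * (exp z - 1) - 1)"
      by (rule norm_triangle_ineq2)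
    finally show ?thesis .
  qed
  have "Re (a * z / (exp z - 1) - c * z) \<le> Re (a * z / (exp z - 1))"
    using ac R z by simp
  also have "\<dots> \<le> norm (a * z / (exp z - 1))"
    by (rule complex_Re_le_cmod)
  also have "\<dots> \<le> a * (R + pi) / (exp R - 1)"
    unfolding norm_divide norm_mult using ac nz nE e1
    by (intro frac_le mult_mono) auto
  finally have "norm (exp (a * z / (exp z - 1) - c * z)) \<le> exp (a * (R + pi) / (exp R - 1))"
    by simp
  then show ?thesis
    unfolding strip_integrand_def norm_divide norm_mult norm_power
    using nE n2 e1 R z
    by (intro frac_le mult_mono power_mono) auto
qed

text \<open>The left edge is near \<open>z = -1\<close>. There \<open>exp \<zeta>\<close> tends to \<open>0\<close>, so \<open>a \<zeta> / (exp \<zeta> - 1) - c \<zeta>\<close> has real part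
about \<open>(a + c) R\<close>, while \<open>exp (3\<zeta>)\<close> contributes \<open>-3R\<close>. The bound decays because \<open>a + c < 3\<close>.\<close>

lemma strip_integrand_left_bound:
  assumes y: "y > 0" and ac: "a > 0" "0 \<le> c" and R: "R > 0"
    and z: "Re z = - R" "\<bar>Im z\<bar> \<le> pi"
  shows "norm (strip_integrand a c y z) \<le>
    exp (- (3 - a - c) * R + a * (R + pi) * exp (- R) / (1 - exp (- R))) / (1 - exp (- R)) ^ 3"
proof -
  have e1: "1 - exp (- R) > 0" using R by simp
  have nE: "1 - exp (- R) \<le> norm (exp z - 1)"
    using norm_triangle_ineq2[of 1 "exp z"] z by (simp add: norm_minus_commute)
  have nz: "norm z \<le> R + pi"
    using cmod_le[of z] z R by simp
  have E1: "exp z - 1 \<noteq> 0"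
    using nE e1 by auto
  have n2: "1 \<le> norm (of_real y * (exp z - 1) - 1)"
  proof -
    have "1 \<le> norm (complex_of_real (1 + y)) - norm (of_real y * exp z)"
      using y z R mult_left_le[of "exp (- R)" y] by (simp add: norm_mult del: of_real_add)
    also have "\<dots> \<le> norm (of_real (1 + y) - of_real y * exp z)"
      by (rule norm_triangle_ineq2)
    also have "of_real (1 + y) - of_real y * exp z = - (of_real y * (exp z - 1) - 1)"
      by (simp add: algebra_simps)
    finally show ?thesis by (simp only: norm_minus_cancel)
  qed
  have "a * z / (exp z - 1) - c * z = - of_real (a + c) * z + a * (z * exp z) / (exp z - 1)"
    using E1 by (simp add: field_simps)
  then have "Re (a * z / (exp z - 1) - c * z) = Re (- of_real (a + c) * z) + Re (a * (z * exp z) / (exp z - 1))"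
    by (simp only: plus_complex.sel)
  also have "Re (- of_real (a + c) * z) = (a + c) * R"
    using z by (simp add: algebra_simps)
  also have "Re (a * (z * exp z) / (exp z - 1)) \<le> norm (a * (z * exp z) / (exp z - 1))"
    by (rule complex_Re_le_cmod)
  also have "\<dots> \<le> a * ((R + pi) * exp (- R)) / (1 - exp (- R))"
    unfolding norm_divide norm_mult using ac nz nE e1 z
    by (intro frac_le mult_mono) auto
  finally have "norm (exp (a * z / (exp z - 1) - c * z)) \<le>
      exp ((a + c) * R + a * ((R + pi) * exp (- R)) / (1 - exp (- R)))"
    by simp
  then have "norm (strip_integrand a c y z) \<le> exp ((a + c) * R + a * ((R + pi) * exp (- R)) / (1 - exp (- R))) * exp (3 * - R) / ((1 - exp (- R)) ^ 3 * 1)"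
    unfolding strip_integrand_def norm_divide norm_mult norm_power
    using nE n2 e1 R z
    by (intro frac_le mult_mono power_mono) auto
  also have "\<dots> = exp (- (3 - a - c) * R + a * (R + pi) * exp (- R) / (1 - exp (- R))) / (1 - exp (- R)) ^ 3"
    by (simp add: algebra_simps flip: exp_add)
  finally show ?thesis .
qed

lemma contour_integral_rectpath_split:
  assumes "f contour_integrable_on linepath p (Complex (Re q) (Im p))"
    and "f contour_integrable_on linepath (Complex (Re q) (Im p)) q"
    and "f contour_integrable_on linepath q (Complex (Re p) (Im q))"
    and "f contour_integrable_on linepath (Complex (Re p) (Im q)) p"
  shows "contour_integral (rectpath p q) f =
    contour_integral (linepath p (Complex (Re q) (Im p))) f +
    contour_integral (linepath (Complex (Re q) (Im p)) q) f +
    contour_integral (linepath q (Complex (Re p) (Im q))) f +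
    contour_integral (linepath (Complex (Re p) (Im q)) p) f"
  using assms by (simp add: rectpath_def Let_def contour_integrable_joinI)

text \<open>The residue theorem on the rectangle \<open>[-R,R] \<times> [-\<pi>,\<pi>]\<close>. The integrand is real on the real axis, so the
lower edge contributes the conjugate of the upper one, and the two together leave only the imaginary
part.\<close>

lemma strip_integrand_contour_identity:
  assumes y: "y > 0" and ac: "a > 0" "0 \<le> c" and R: "R > ln (1 + 1 / y)"
    and Bl: "\<And>z. Re z = - R \<Longrightarrow> \<bar>Im z\<bar> \<le> pi \<Longrightarrow> norm (strip_integrand a c y z) \<le> Bl"
    and Br: "\<And>z. Re z = R \<Longrightarrow> \<bar>Im z\<bar> \<le> pi \<Longrightarrow> norm (strip_integrand a c y z) \<le> Br"
  shows "\<bar>pi * (exp a * ((1 + y)\<^sup>2 - q1 a c * (1 + y) - (q1 a c - q2 a c)) - H_fun a c y * (1 + y)\<^sup>2)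
           - integral {-R..R} (\<lambda>x. Im (strip_integrand a c y (Complex x pi)))\<bar> \<le> pi * (Bl + Br)"
proof -
  let ?F = "strip_integrand a c y" and ?l = "ln (1 + 1 / y)"
  let ?p = "Complex (- R) (- pi)" and ?q = "Complex R pi"
  let ?p2 = "Complex R (- pi)" and ?q2 = "Complex (- R) pi"
  let ?P = "exp a * ((1 + y)\<^sup>2 - q1 a c * (1 + y) - (q1 a c - q2 a c))" and ?H = "H_fun a c y * (1 + y)\<^sup>2"
  have l: "?l > 0" by (rule ln_one_plus_inverse_pos[OF y])
  have R0: "R > 0" using l R by simp
  have pi2: "pi < 2 * pi" by simp
  define S where "S = strip - {0, complex_of_real ?l}"
  have cont: "continuous_on S ?F"
    unfolding S_def by (intro holomorphic_on_imp_continuous_on holomorphic_strip_integrand y)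
  have segS: "closed_segment u v \<subseteq> S"
    if "\<And>z. z \<in> closed_segment u v \<Longrightarrow> \<bar>Im z\<bar> \<le> pi \<and> (\<bar>Re z\<bar> = R \<or> \<bar>Im z\<bar> = pi)" for u v
  proof
    fix z assume "z \<in> closed_segment u v"
    from that[OF this] show "z \<in> S"
      using R R0 l pi_gt_zero by (auto simp: S_def strip_def simp del: pi_gt_zero)
  qed
  have seg1: "closed_segment ?p ?p2 \<subseteq> S" "closed_segment ?p2 ?q \<subseteq> S" "closed_segment ?q ?q2 \<subseteq> S" "closed_segment ?q2 ?p \<subseteq> S"
    by (rule segS; use R0 in \<open>auto simp: closed_segment_same_Im closed_segment_same_Re closed_segment_eq_real_ivl split: if_splits\<close>)+
  have ci: "?F contour_integrable_on linepath u v" if "closed_segment u v \<subseteq> S" for u v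
    using continuous_on_subset[OF cont that] by (rule contour_integrable_continuous_linepath)
  note ci1 = ci[OF seg1(1)] and ci2 = ci[OF seg1(2)] and ci3 = ci[OF seg1(3)] and ci4 = ci[OF seg1(4)]
  let ?C = "\<lambda>u v. contour_integral (linepath u v) ?F"
  have split: "contour_integral (rectpath ?p ?q) ?F = ?C ?p ?p2 + ?C ?p2 ?q + ?C ?q ?q2 + ?C ?q2 ?p"
    using contour_integral_rectpath_split[of ?F ?p ?q] ci1 ci2 ci3 ci4 by simp
  have res: "contour_integral (rectpath ?p ?q) ?F = 2 * pi * \<i> * of_real (?H - ?P)"
  proof -
    have "contour_integral (rectpath ?p ?q) ?F = 2 * pi * \<i> *
        (\<Sum>z\<in>{0, complex_of_real ?l}. winding_number (rectpath ?p ?q) z * residue ?F z)"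
    proof (rule Residue_theorem[OF open_strip connected_strip])
      show "?F holomorphic_on strip - {0, of_real ?l}"
        by (rule holomorphic_strip_integrand[OF y])
      have "path_image (rectpath ?p ?q) = closed_segment ?p ?p2 \<union> closed_segment ?p2 ?q \<union> closed_segment ?q ?q2 \<union> closed_segment ?q2 ?p"
        by (simp add: rectpath_def Let_def path_image_join Un_assoc)
      then show "path_image (rectpath ?p ?q) \<subseteq> strip - {0, of_real ?l}"
        using seg1 by (simp add: S_def)
      show "\<forall>z. z \<notin> strip \<longrightarrow> winding_number (rectpath ?p ?q) z = 0"
        using R0 pi_gt_zero
        by (auto simp: strip_def in_cbox_complex_iff simp del: pi_gt_zero intro!: winding_number_rectpath_outside)
    qed auto
    also have "winding_number (rectpath ?p ?q) 0 = 1" "winding_number (rectpath ?p ?q) (of_real ?l) = 1"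
      using R R0 l pi2 by (auto intro!: winding_number_rectpath simp: in_box_complex_iff)
    then have "(\<Sum>z\<in>{0, complex_of_real ?l}. winding_number (rectpath ?p ?q) z * residue ?F z)
        = of_real (?H - ?P)"
      using l by (simp add: residue_strip_integrand_0[OF y] residue_strip_integrand_pole[OF y])
    finally show ?thesis .
  qed
  have hor: "Im (?C ?p ?p2 + ?C ?q ?q2) = - 2 * integral {-R..R} (\<lambda>x. Im (?F (Complex x pi)))"
  proof -
    have cont_top: "continuous_on {-R..R} (\<lambda>x. ?F (Complex x pi))"
    proof (rule continuous_on_compose2[OF cont])
      show "continuous_on {-R..R} (\<lambda>x. Complex x pi)"
        unfolding Complex_eq by (intro continuous_intros)
      show "(\<lambda>x. Complex x pi) ` {-R..R} \<subseteq> S"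
        using pi2 by (auto simp: S_def strip_def complex_eq_iff)
    qed
    then have int: "(\<lambda>x. ?F (Complex x pi)) integrable_on {-R..R}"
      by (rule integrable_continuous_real)
    let ?I = "integral {-R..R} (\<lambda>x. ?F (Complex x pi))"
    have "?C ?q ?q2 = - ?C ?q2 ?q"
      using ci3 by (intro contour_integral_reverse_linepath) (rule continuous_on_subset[OF cont seg1(3)])
    also have "?C ?q2 ?q = ?I"
      using R0 by (intro contour_integral_linepath_horizontal) auto
    finally have top: "?C ?q ?q2 = - ?I" .
    have "?C ?p ?p2 = integral {-R..R} (\<lambda>x. ?F (Complex x (- pi)))"
      using R0 by (intro contour_integral_linepath_horizontal) auto
    also have "(\<lambda>x. ?F (Complex x (- pi))) = (\<lambda>x. cnj (?F (Complex x pi)))"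
      by (simp add: strip_integrand_cnj[symmetric] complex_cnj)
    also have "integral {-R..R} (\<lambda>x. cnj (?F (Complex x pi))) = cnj ?I"
      using integral_linear[OF int bounded_linear_cnj] by (simp add: o_def)
    finally have bot: "?C ?p ?p2 = cnj ?I" .
    have "Im ?I = integral {-R..R} (\<lambda>x. Im (?F (Complex x pi)))"
      using integral_linear[OF int bounded_linear_Im] by (simp add: o_def)
    then show ?thesis
      unfolding top bot by simp
  qed
  have Bl0: "Bl \<ge> 0"
    by (rule order_trans[OF norm_ge_zero Bl[of ?q2]]) auto
  have Br0: "Br \<ge> 0"
    by (rule order_trans[OF norm_ge_zero Br[of ?q]]) auto
  have right: "norm (?C ?p2 ?q) \<le> Br * (2 * pi)"
  proof -
    have "norm (?C ?p2 ?q) \<le> Br * norm (?q - ?p2)"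
      by (rule contour_integral_bound_linepath[OF ci2 Br0], rule Br)
        (auto simp: closed_segment_same_Re closed_segment_eq_real_ivl)
    also have "norm (?q - ?p2) = 2 * pi"
      by (simp add: cmod_eq_Im)
    finally show ?thesis .
  qed
  have left: "norm (?C ?q2 ?p) \<le> Bl * (2 * pi)"
  proof -
    have "norm (?C ?q2 ?p) \<le> Bl * norm (?p - ?q2)"
      by (rule contour_integral_bound_linepath[OF ci4 Bl0], rule Bl)
        (auto simp: closed_segment_same_Re closed_segment_eq_real_ivl split: if_splits)
    also have "norm (?p - ?q2) = 2 * pi"
      by (simp add: cmod_eq_Im)
    finally show ?thesis .
  qed
  have "2 * pi * (?H - ?P) = Im (contour_integral (rectpath ?p ?q) ?F)"
    unfolding res by simp
  also have "\<dots> = - 2 * integral {-R..R} (\<lambda>x. Im (?F (Complex x pi))) + Im (?C ?p2 ?q) + Im (?C ?q2 ?p)"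
    unfolding split hor[symmetric] by simp
  finally have eq: "2 * (pi * (?P - ?H) - integral {-R..R} (\<lambda>x. Im (?F (Complex x pi)))) = - (Im (?C ?p2 ?q) + Im (?C ?q2 ?p))"
    by (simp add: algebra_simps)
  have "\<bar>Im (?C ?p2 ?q)\<bar> \<le> Br * (2 * pi)" "\<bar>Im (?C ?q2 ?p)\<bar> \<le> Bl * (2 * pi)"
    by (rule order_trans[OF abs_Im_le_cmod right], rule order_trans[OF abs_Im_le_cmod left])
  moreover have "2 * \<bar>T\<bar> \<le> X + Y" if "2 * T = - (u + v)" "\<bar>u\<bar> \<le> X" "\<bar>v\<bar> \<le> Y" for T u v X Y :: real
    using that by linarith
  ultimately have "2 * \<bar>pi * (?P - ?H) - integral {-R..R} (\<lambda>x. Im (?F (Complex x pi)))\<bar> \<le> Br * (2 * pi) + Bl * (2 * pi)"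
    using eq by blast
  also have "\<dots> = 2 * (pi * (Bl + Br))"
    by (simp add: algebra_simps)
  finally show ?thesis
    by simp
qed

text \<open>As \<open>R \<rightarrow> \<infinity>\<close> the bounds for the vertical edges tend to \<open>0\<close>, and the integral over the upper edge tends to
the integral over the whole line, which the substitution \<open>x \<mapsto> s\<close> turns into the integral over \<open>(0,1)\<close>.\<close>

lemma H_fun_integral_representation:
  assumes ac: "a > 0" "0 \<le> c" "a + c < 3" and y: "y > 0"
  shows "(1 + y)\<^sup>2 * (exp a - H_fun a c y) = exp a * (q1 a c * (1 + y) + (q1 a c - q2 a c))
           + (LBINT s:{0<..<1}. w_fun a c s * (1 - s)\<^sup>2 / (y + s))"
proof -
  let ?k = "\<lambda>x. Im (strip_integrand a c y (Complex x pi))"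
  define J where "J = (LBINT s:{0<..<1}. w_fun a c s * (1 - s)\<^sup>2 / (y + s))"
  define Q where "Q = exp a * ((1 + y)\<^sup>2 - q1 a c * (1 + y) - (q1 a c - q2 a c)) - H_fun a c y * (1 + y)\<^sup>2"
  define Bl where "Bl R = exp (- (3 - a - c) * R + a * (R + pi) * exp (- R) / (1 - exp (- R))) / (1 - exp (- R)) ^ 3" for R
  define Br where "Br R = exp (a * (R + pi) / (exp R - 1)) * exp (3 * R) / ((exp R - 1) ^ 3 * (y * (exp R - 1) - 1))" for R
  define d where "d = 3 - a - c"
  have d: "d > 0" using ac by (simp add: d_def)
  have Bl: "(Bl \<longlongrightarrow> 0) at_top"
  proof -
    have 1: "((\<lambda>R. exp (- d * R)) \<longlongrightarrow> 0) at_top"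
      using d by real_asymp
    have 2: "((\<lambda>R. (R + pi) * exp (- R) / (1 - exp (- R))) \<longlongrightarrow> 0) at_top"
      by real_asymp
    have 3: "((\<lambda>R::real. 1 - exp (- R)) \<longlongrightarrow> 1) at_top"
      by real_asymp
    have "((\<lambda>R. exp (- d * R) * exp (a * ((R + pi) * exp (- R) / (1 - exp (- R)))) / (1 - exp (- R)) ^ 3)
        \<longlongrightarrow> 0 * exp (a * 0) / 1 ^ 3) at_top"
      by (intro tendsto_intros 1 2 3) auto
    then show ?thesis
      by (simp add: Bl_def[abs_def] d_def exp_add mult.assoc)
  qed
  have Br: "(Br \<longlongrightarrow> 0) at_top"
  proof -
    have 1: "((\<lambda>R. (R + pi) / (exp R - 1)) \<longlongrightarrow> 0) at_top"
      by real_asymp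
    have 2: "((\<lambda>R::real. exp (3 * R) / (exp R - 1) ^ 3) \<longlongrightarrow> 1) at_top"
      by real_asymp
    have 3: "((\<lambda>R. 1 / (y * (exp R - 1) - 1)) \<longlongrightarrow> 0) at_top"
      using y by real_asymp
    have "((\<lambda>R. exp (a * ((R + pi) / (exp R - 1))) * (exp (3 * R) / (exp R - 1) ^ 3) * (1 / (y * (exp R - 1) - 1)))
        \<longlongrightarrow> exp (a * 0) * 1 * 0) at_top"
      by (intro tendsto_intros 1 2 3)
    then show ?thesis
      by (simp add: Br_def[abs_def] mult.assoc)
  qed
  have int: "((\<lambda>R. integral {-R..R} ?k) \<longlongrightarrow> pi * J) at_top"
  proof (rule tendstoI)
    fix e :: real assume e: "e > 0"
    have "(?k has_integral pi * J) UNIV"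
      unfolding J_def by (rule has_integral_Im_strip_integrand_upper[OF ac y])
    then have "\<forall>e>0. \<exists>B>0. \<forall>u v. ball 0 B \<subseteq> cbox u v \<longrightarrow>
        norm (integral (cbox u v) (\<lambda>x. if x \<in> UNIV then ?k x else 0) - pi * J) < e"
      by (subst (asm) has_integral_alt') (erule conjunct2)
    then have "\<exists>B>0. \<forall>u v. ball 0 B \<subseteq> cbox u v \<longrightarrow> norm (integral (cbox u v) ?k - pi * J) < e"
      using e by (simp only: UNIV_I if_True)
    then obtain B where B: "B > 0" "\<And>u v. ball 0 B \<subseteq> cbox u v \<Longrightarrow> norm (integral (cbox u v) ?k - pi * J) < e"
      by blast
    show "\<forall>\<^sub>F R in at_top. dist (integral {-R..R} ?k) (pi * J) < e"
      using eventually_ge_at_top[of B]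
    proof eventually_elim
      case (elim R)
      then have "ball 0 B \<subseteq> cbox (- R) R"
        by (auto simp: dist_norm)
      from B(2)[OF this] show ?case
        by (simp add: dist_norm)
    qed
  qed
  have "filterlim (\<lambda>R. y * (exp R - 1)) at_top at_top"
    using y by real_asymp
  then have "\<forall>\<^sub>F R in at_top. 1 < y * (exp R - 1)"
    by (simp add: filterlim_at_top_dense)
  then have ev: "\<forall>\<^sub>F R in at_top. norm (pi * Q - integral {-R..R} ?k) \<le> pi * (Bl R + Br R)"
    using eventually_gt_at_top[of "ln (1 + 1 / y)"]
  proof eventually_elim
    case (elim R)
    have R: "R > 0"
      using elim ln_one_plus_inverse_pos[OF y] by simp
    show ?case
      unfolding Q_def real_norm_def
    proof (rule strip_integrand_contour_identity[OF y ac(1,2) elim(2)])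
      show "norm (strip_integrand a c y z) \<le> Bl R" if "Re z = - R" "\<bar>Im z\<bar> \<le> pi" for z
        unfolding Bl_def by (rule strip_integrand_left_bound[OF y ac(1,2) R that])
      show "norm (strip_integrand a c y z) \<le> Br R" if "Re z = R" "\<bar>Im z\<bar> \<le> pi" for z
        unfolding Br_def by (rule strip_integrand_right_bound[OF y ac(1,2) R elim(1) that])
    qed
  qed
  have "((\<lambda>R. pi * (Bl R + Br R)) \<longlongrightarrow> pi * (0 + 0)) at_top"
    by (intro tendsto_intros Bl Br)
  then have "((\<lambda>R. pi * (Bl R + Br R)) \<longlongrightarrow> 0) at_top"
    by simp
  with ev have "((\<lambda>R. pi * Q - integral {-R..R} ?k) \<longlongrightarrow> 0) at_top"
    by (rule Lim_null_comparison)
  moreover have "((\<lambda>R. pi * Q - integral {-R..R} ?k) \<longlongrightarrow> pi * Q - pi * J) at_top"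
    by (intro tendsto_intros int)
  ultimately have "pi * Q - pi * J = 0"
    by (rule tendsto_unique[OF trivial_limit_at_top_linorder, rotated])
  then have "Q = J" by simp
  then show ?thesis
    by (simp add: Q_def J_def algebra_simps)
qed

section \<open>Moments of Laplace transforms\<close>

text \<open>The peak of \<open>x e\<^sup>1\<^sup>-\<^sup>x\<close> at \<open>x = 1\<close>, with an explicit gap away from it. With \<open>h = x - 1\<close> the bound follows from
\<open>e\<^sup>h \<ge> (1 + h/2)\<^sup>2 = (1 + h) + h\<^sup>2/4\<close>.\<close>

lemma mult_exp_one_minus_le:
  fixes x d :: real
  assumes x: "x \<ge> 0" and d: "d > 0" "\<bar>x - 1\<bar> \<ge> d"
  shows "x * exp (1 - x) \<le> 1 / (1 + d\<^sup>2 / (4 * (1 + d)))"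
proof (cases "x = 0")
  case False
  then have x: "x > 0" using x by simp
  have "(1 + (x - 1) / 2)\<^sup>2 \<le> (exp ((x - 1) / 2))\<^sup>2"
    using x exp_ge_add_one_self[of "(x - 1) / 2"] by (intro power_mono) (auto simp: field_simps)
  also have "\<dots> = exp (x - 1)"
    by (simp flip: exp_of_nat_mult exp_double)
  finally have e: "x + (x - 1)\<^sup>2 / 4 \<le> exp (x - 1)"
    by (simp add: power2_eq_square field_simps)
  have "d\<^sup>2 * x \<le> (x - 1)\<^sup>2 * (1 + d)"
  proof (cases "x \<ge> 1")
    case True
    define h where "h = x - 1"
    have h: "h \<ge> d" using True d by (simp add: h_def)
    have "0 \<le> (h - d) * (h + d) + d * h * (h - d)"
      using h d by (intro add_nonneg_nonneg mult_nonneg_nonneg) auto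
    then have "d\<^sup>2 * (1 + h) \<le> h\<^sup>2 * (1 + d)"
      by (simp add: power2_eq_square algebra_simps)
    then show ?thesis by (simp add: h_def)
  next
    case False
    then have "d\<^sup>2 \<le> (1 - x)\<^sup>2" using d by (intro power_mono) auto
    then have "d\<^sup>2 * x \<le> (1 - x)\<^sup>2 * (1 + d)"
      using False x d by (intro mult_mono) auto
    then show ?thesis by (simp add: power2_commute)
  qed
  then have "x * (1 + d\<^sup>2 / (4 * (1 + d))) \<le> x + (x - 1)\<^sup>2 / 4"
    using d by (simp add: field_simps)
  also note e
  finally have "x * (1 + d\<^sup>2 / (4 * (1 + d))) * exp (1 - x) \<le> exp (x - 1) * exp (1 - x)"
    by (rule mult_right_mono) simp
  also have "\<dots> = 1"
    by (simp flip: exp_add)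
  finally show ?thesis
    using d by (simp add: pos_le_divide_eq add_pos_nonneg mult_ac)
qed (use d in auto)

text \<open>With \<open>y = n/t\<^sub>0\<close> the kernel \<open>t\<^sup>n e\<^sup>-\<^sup>y\<^sup>t\<close> is a constant times the \<open>n\<close>-th power of \<open>k(t) = (t/t\<^sub>0) exp (1 - t/t\<^sub>0)\<close>,
which is \<open>1\<close> at \<open>t\<^sub>0\<close> and smaller elsewhere. Away from \<open>t\<^sub>0\<close> we have \<open>k \<le> \<rho> < 1\<close>, and on a smaller neighbourhood
\<open>k \<ge> \<rho>'\<close> for some \<open>\<rho>' > \<rho>\<close>. Hence the negative values of \<open>\<phi>\<close> near \<open>t\<^sub>0\<close> outweigh the rest for large \<open>n\<close>.\<close>

lemma laplace_moment_neg:
  fixes \<phi> :: "real \<Rightarrow> real"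
  assumes int: "set_integrable lborel {0<..} \<phi>"
    and cont: "isCont \<phi> t0" and t0: "t0 > 0" and neg: "\<phi> t0 < 0"
  shows "\<exists>n>0. \<exists>y>0. (LBINT t:{0<..}. t ^ n * exp (- y * t) * \<phi> t) < 0"
proof -
  define k where "k t = t / t0 * exp (1 - t / t0)" for t
  define e where "e = - \<phi> t0 / 2"
  have e: "e > 0" using neg by (simp add: e_def)
  have e2: "\<phi> t0 < - e" using neg by (simp add: e_def)
  have "\<forall>\<^sub>F t in at t0. \<phi> t < - e"
    using cont neg by (intro order_tendstoD(2)[of \<phi> "\<phi> t0"]) (auto simp: isCont_def e_def)
  then obtain \<delta> where \<delta>: "\<delta> > 0" "\<And>t. \<bar>t - t0\<bar> < \<delta> \<Longrightarrow> \<phi> t \<le> - e"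
  proof -
    obtain \<delta> where \<delta>: "\<delta> > 0" "\<And>t. t \<noteq> t0 \<Longrightarrow> \<bar>t - t0\<bar> < \<delta> \<Longrightarrow> \<phi> t < - e"
      using \<open>\<forall>\<^sub>F t in at t0. \<phi> t < - e\<close> unfolding eventually_at by (auto simp: dist_real_def)
    show ?thesis
    proof (rule that[OF \<delta>(1)])
      show "\<phi> t \<le> - e" if "\<bar>t - t0\<bar> < \<delta>" for t
        using \<delta>(2)[of t] that e2 by (cases "t = t0") auto
    qed
  qed
  define d where "d = \<delta> / t0"
  define \<rho> where "\<rho> = 1 / (1 + d\<^sup>2 / (4 * (1 + d)))"
  have d: "d > 0" using \<delta> t0 by (simp add: d_def)
  have \<rho>: "0 < \<rho>" "\<rho> < 1"
    using d by (auto simp: \<rho>_def divide_simps add_pos_pos)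
  have far: "k t \<le> \<rho>" if "t > 0" "\<bar>t - t0\<bar> \<ge> \<delta>" for t
  proof -
    have "\<bar>t / t0 - 1\<bar> = \<bar>t - t0\<bar> / t0"
    proof -
      have "t / t0 - 1 = (t - t0) / t0"
        using t0 by (simp add: diff_divide_distrib)
      then show ?thesis
        using t0 by simp
    qed
    then have "\<bar>t / t0 - 1\<bar> \<ge> d"
      using that t0 by (simp add: d_def divide_right_mono)
    then show ?thesis
      unfolding k_def \<rho>_def using that t0 d by (intro mult_exp_one_minus_le) auto
  qed
  define \<rho>' where "\<rho>' = (1 + \<rho>) / 2"
  have \<rho>': "\<rho> < \<rho>'" "\<rho>' < 1" "0 < \<rho>'" using \<rho> by (auto simp: \<rho>'_def)
  have "isCont k t0"
    unfolding k_def using t0 by (intro continuous_intros) auto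
  moreover have "k t0 = 1"
    using t0 by (simp add: k_def)
  ultimately have "\<forall>\<^sub>F t in at t0. \<rho>' < k t"
    using \<rho>' by (intro order_tendstoD(1)[of k 1]) (auto simp: isCont_def)
  then obtain \<eta> where \<eta>: "\<eta> > 0" "\<And>t. t \<noteq> t0 \<Longrightarrow> \<bar>t - t0\<bar> < \<eta> \<Longrightarrow> \<rho>' < k t"
    unfolding eventually_at by (auto simp: dist_real_def)
  define \<delta>' where "\<delta>' = min (min \<delta> \<eta>) t0"
  have \<delta>': "\<delta>' > 0" "\<delta>' \<le> \<delta>" "\<delta>' \<le> \<eta>" "\<delta>' \<le> t0"
    using \<delta> \<eta> t0 by (auto simp: \<delta>'_def)
  have near: "\<rho>' \<le> k t" if "t \<in> {t0 - \<delta>'<..<t0 + \<delta>'}" for t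
    using \<eta>(2)[of t] that \<delta>' \<open>k t0 = 1\<close> \<rho>' by (cases "t = t0") (auto simp: abs_less_iff)
  have k_nonneg: "k t \<ge> 0" if "t > 0" for t
    using that t0 by (simp add: k_def)
  have k_le: "k t \<le> 1" if "t > 0" for t
  proof -
    have "t / t0 \<le> exp (t / t0 - 1)"
      using exp_ge_add_one_self[of "t / t0 - 1"] by simp
    then have "t / t0 * exp (1 - t / t0) \<le> exp (t / t0 - 1) * exp (1 - t / t0)"
      by (rule mult_right_mono) simp
    then show ?thesis by (simp add: k_def flip: exp_add)
  qed
  define A where "A = (LBINT t:{0<..}. \<bar>\<phi> t\<bar>)"
  have absint: "set_integrable lborel {0<..} (\<lambda>t. \<bar>\<phi> t\<bar>)"
    using set_integrable_abs[OF int] .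
  have Jn: "(LBINT t:{0<..}. k t ^ n * \<phi> t) \<le> \<rho> ^ n * A - e * \<rho>' ^ n * (2 * \<delta>')" for n
  proof -
    let ?S = "{t0 - \<delta>'<..<t0 + \<delta>'}"
    let ?g = "\<lambda>t. indicator {0<..} t * (\<rho> ^ n * \<bar>\<phi> t\<bar>) - e * \<rho>' ^ n * indicator ?S t"
    have i1: "integrable lborel (\<lambda>t. indicator {0<..} t * (\<rho> ^ n * \<bar>\<phi> t\<bar>))"
      using set_integrable_mult_right[OF absint] by (simp add: set_integrable_def)
    have i2: "integrable lborel (\<lambda>t. e * \<rho>' ^ n * indicator ?S t)"
      by (intro integrable_mult_right integrable_real_indicator) (use \<delta>' in auto)
    have "(LBINT t:{0<..}. k t ^ n * \<phi> t) \<le> (\<integral>t. ?g t \<partial>lborel)"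
      unfolding set_lebesgue_integral_def
    proof (rule integral_mono)
      have "set_integrable lborel {0<..} (\<lambda>t. k t ^ n * \<phi> t)"
      proof (rule set_integrable_bound[OF int])
        show "set_borel_measurable lborel {0<..} (\<lambda>t. k t ^ n * \<phi> t)"
        proof -
          have "(\<lambda>t. k t ^ n * (indicator {0<..} t *\<^sub>R \<phi> t)) \<in> borel_measurable lborel"
            using int unfolding k_def set_integrable_def by (intro borel_measurable_times) (auto dest: borel_measurable_integrable)
          then show ?thesis
            unfolding set_borel_measurable_def by (simp add: mult_ac)
        qed
        show "AE t in lborel. t \<in> {0<..} \<longrightarrow> norm (k t ^ n * \<phi> t) \<le> norm (\<phi> t)"
          using k_nonneg k_le by (intro AE_I2) (auto simp: abs_mult power_le_one intro!: mult_left_le_one_le)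
      qed
      then show "integrable lborel (\<lambda>t. indicator {0<..} t *\<^sub>R (k t ^ n * \<phi> t))"
        by (simp add: set_integrable_def)
      show "integrable lborel ?g"
        using i1 i2 by (rule Bochner_Integration.integrable_diff)
      fix t :: real
      have "k t ^ n * \<phi> t \<le> \<rho> ^ n * \<bar>\<phi> t\<bar> - e * \<rho>' ^ n * indicator ?S t" if t: "t > 0"
      proof (cases "\<bar>t - t0\<bar> < \<delta>")
        case True
        have "k t ^ n * \<phi> t \<le> k t ^ n * (- e)"
          using \<delta>(2)[OF True] k_nonneg[OF t] by (intro mult_left_mono) auto
        also have "\<dots> \<le> - (e * \<rho>' ^ n * indicator ?S t)"
          using near[of t] e \<rho>' k_nonneg[OF t] by (auto simp: indicator_def intro!: power_mono)
        also have "\<dots> \<le> \<rho> ^ n * \<bar>\<phi> t\<bar> - e * \<rho>' ^ n * indicator ?S t"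
          using \<rho> by simp
        finally show ?thesis .
      next
        case False
        then have "t \<notin> ?S" using \<delta>' by (auto simp: abs_if split: if_splits)
        moreover have "k t ^ n * \<phi> t \<le> k t ^ n * \<bar>\<phi> t\<bar>"
          using k_nonneg[OF t] by (intro mult_left_mono) auto
        moreover have "k t ^ n * \<bar>\<phi> t\<bar> \<le> \<rho> ^ n * \<bar>\<phi> t\<bar>"
          using far[OF t] False k_nonneg[OF t] by (intro mult_right_mono power_mono) auto
        ultimately show ?thesis by simp
      qed
      moreover have "t \<notin> ?S" if "\<not> t > 0"
        using that \<delta>' by auto
      ultimately show "indicator {0<..} t *\<^sub>R (k t ^ n * \<phi> t) \<le> ?g t"
        by (auto simp: indicator_def)
    qed
    also have "\<dots> = \<rho> ^ n * A - e * \<rho>' ^ n * (2 * \<delta>')"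
    proof -
      have "(\<integral>t. indicator {0<..} t * (\<rho> ^ n * \<bar>\<phi> t\<bar>) \<partial>lborel) = \<rho> ^ n * A"
        unfolding A_def set_lebesgue_integral_def by (simp add: mult.left_commute)
      moreover have "(\<integral>t. e * \<rho>' ^ n * indicator ?S t \<partial>lborel) = e * \<rho>' ^ n * (2 * \<delta>')"
        using \<delta>' by simp
      ultimately show ?thesis
        using i1 i2 by simp
    qed
    finally show ?thesis .
  qed
  have "(\<lambda>n. (\<rho> / \<rho>') ^ n * A) \<longlonglongrightarrow> 0 * A"
    using \<rho> \<rho>' by (intro tendsto_intros LIMSEQ_power_zero) auto
  then have "\<forall>\<^sub>F n in sequentially. (\<rho> / \<rho>') ^ n * A < e * (2 * \<delta>')"
    using e \<delta>' by (intro order_tendstoD) auto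
  moreover have "\<forall>\<^sub>F n in sequentially. n > (0::nat)"
    by (rule eventually_gt_at_top)
  ultimately have "\<forall>\<^sub>F n in sequentially. n > 0 \<and> (\<rho> / \<rho>') ^ n * A < e * (2 * \<delta>')"
    by eventually_elim simp
  then obtain n where n: "n > 0" "(\<rho> / \<rho>') ^ n * A < e * (2 * \<delta>')"
    by (auto simp: eventually_sequentially)
  have "\<rho> ^ n * A = \<rho>' ^ n * ((\<rho> / \<rho>') ^ n * A)"
    using \<rho>' by (simp add: power_divide)
  also have "\<dots> < \<rho>' ^ n * (e * (2 * \<delta>'))"
    using n \<rho>' by (intro mult_strict_left_mono) auto
  finally have "(LBINT t:{0<..}. k t ^ n * \<phi> t) < 0"
    using Jn[of n] by (simp add: mult_ac)
  moreover have "k t ^ n * \<phi> t = exp n / t0 ^ n * (t ^ n * exp (- (n / t0) * t) * \<phi> t)" for t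
  proof -
    have "exp (1 - t / t0) ^ n = exp n * exp (- (n / t0) * t)"
      by (simp add: algebra_simps flip: exp_add exp_of_nat_mult)
    then show ?thesis
      by (simp add: k_def power_mult_distrib power_divide)
  qed
  ultimately have "exp n / t0 ^ n * (LBINT t:{0<..}. t ^ n * exp (- (n / t0) * t) * \<phi> t) < 0"
    by simp
  then have "(LBINT t:{0<..}. t ^ n * exp (- (n / t0) * t) * \<phi> t) < 0"
    using t0 by (simp add: mult_less_0_iff zero_less_mult_iff divide_less_0_iff)
  then show ?thesis
    using n t0 by (intro exI[of _ n] conjI exI[of _ "n / t0"]) auto
qed

lemma power_mult_exp_minus_le:
  assumes "y > 0" "t \<ge> (0::real)"
  shows "t ^ n * exp (- y * t) \<le> fact n / y ^ n"
proof -
  have "(y * t) ^ n /\<^sub>R fact n \<le> exp (y * t)"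
    unfolding exp_def using sum_le_suminf[OF summable_exp_generic[of "y * t"], of "{n}"] assms by simp
  then have "(y * t) ^ n * exp (- y * t) \<le> fact n"
    by (simp add: exp_minus field_simps)
  then show ?thesis
    using assms by (simp add: field_simps power_mult_distrib)
qed

lemma set_integrable_laplace_moment:
  fixes \<phi> :: "real \<Rightarrow> real"
  assumes int: "set_integrable lborel {0<..} \<phi>" and y: "y > 0"
  shows "set_integrable lborel {0<..} (\<lambda>t. t ^ n * exp (- y * t) * \<phi> t)"
proof (rule set_integrable_bound)
  show "set_integrable lborel {0<..} (\<lambda>t. fact n / y ^ n * \<phi> t)"
    using int by simp
  have "(\<lambda>t. t ^ n * exp (- y * t) * (indicator {0<..} t *\<^sub>R \<phi> t)) \<in> borel_measurable lborel"
    using int unfolding set_integrable_def by (intro borel_measurable_times) (auto dest: borel_measurable_integrable)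
  then show "set_borel_measurable lborel {0<..} (\<lambda>t. t ^ n * exp (- y * t) * \<phi> t)"
    unfolding set_borel_measurable_def by (simp add: mult_ac)
  have "norm (t ^ n * exp (- y * t) * \<phi> t) \<le> norm (fact n / y ^ n * \<phi> t)" if "t > 0" for t
    unfolding norm_mult[of _ "\<phi> t"] using power_mult_exp_minus_le[OF y, of t n] that y
    by (intro mult_right_mono) auto
  then show "AE t in lborel. t \<in> {0<..} \<longrightarrow> norm (t ^ n * exp (- y * t) * \<phi> t) \<le> norm (fact n / y ^ n * \<phi> t)"
    by simp
qed

text \<open>For \<open>|h| < y/2\<close> the Taylor remainder of \<open>exp (-(y+h)t)\<close> in \<open>h\<close> is at most \<open>h\<^sup>2 t\<^sup>2 exp (-y t/2)\<close>, and the
corresponding moment at \<open>y/2\<close> converges.\<close>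

lemma has_field_derivative_laplace_moment:
  fixes \<phi> :: "real \<Rightarrow> real"
  assumes int: "set_integrable lborel {0<..} \<phi>" and y: "y > 0"
  shows "((\<lambda>y. LBINT t:{0<..}. t ^ n * exp (- y * t) * \<phi> t) has_field_derivative
           - (LBINT t:{0<..}. t ^ Suc n * exp (- y * t) * \<phi> t)) (at y)"
proof -
  let ?I = "indicat_real {0<..}"
  have i: "integrable lborel (\<lambda>t. ?I t *\<^sub>R (t ^ m * exp (- z * t) * \<phi> t))" if "z > 0" for m z
    using set_integrable_laplace_moment[OF int that] by (simp add: set_integrable_def)
  have "((\<lambda>y. \<integral>t. ?I t *\<^sub>R (t ^ n * exp (- y * t) * \<phi> t) \<partial>lborel) has_field_derivative
     (\<integral>t. - (?I t *\<^sub>R (t ^ Suc n * exp (- y * t) * \<phi> t)) \<partial>lborel)) (at y)"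
  proof (rule has_field_derivative_integral_quadratic_remainder[where \<delta> = "y / 2"])
    let ?B = "\<lambda>t. ?I t *\<^sub>R (t ^ (n + 2) * exp (- (y / 2) * t) * \<bar>\<phi> t\<bar>)"
    show "integrable lborel (\<lambda>t. ?I t *\<^sub>R (t ^ n * exp (- (y + h) * t) * \<phi> t))" if "norm h < y / 2" for h
      using that y by (intro i) (auto simp: abs_if split: if_splits)
    show "integrable lborel (\<lambda>t. - (?I t *\<^sub>R (t ^ Suc n * exp (- y * t) * \<phi> t)))"
      using i[OF y] by (intro Bochner_Integration.integrable_minus)
    show "integrable lborel ?B"
      using set_integrable_laplace_moment[OF set_integrable_abs[OF int], of "y / 2" "n + 2"] y by (simp add: set_integrable_def)
    fix h t :: real
    assume h: "norm h < y / 2"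
    have "\<bar>t ^ n * exp (- (y + h) * t) * \<phi> t - t ^ n * exp (- y * t) * \<phi> t + h * (t ^ Suc n * exp (- y * t) * \<phi> t)\<bar>
        \<le> h\<^sup>2 * (t ^ (n + 2) * exp (- (y / 2) * t) * \<bar>\<phi> t\<bar>)" if t: "t > 0"
    proof -
      have "\<bar>exp (- h * t) - 1 - (- h * t)\<bar> \<le> (\<bar>h\<bar> * t)\<^sup>2 * exp (\<bar>h\<bar> * t)"
        using norm_exp_minus_1_minus_self_le[of "- h * t"] t by (simp add: abs_mult)
      also have "\<dots> \<le> (\<bar>h\<bar> * t)\<^sup>2 * exp (y / 2 * t)"
        using h t by (intro mult_left_mono) (auto intro!: mult_right_mono)
      finally have "\<bar>exp (- h * t) - 1 - (- h * t)\<bar> \<le> h\<^sup>2 * t\<^sup>2 * exp (y / 2 * t)"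
        by (simp add: power_mult_distrib)
      then have "t ^ n * exp (- y * t) * \<bar>\<phi> t\<bar> * \<bar>exp (- h * t) - 1 - (- h * t)\<bar>
          \<le> t ^ n * exp (- y * t) * \<bar>\<phi> t\<bar> * (h\<^sup>2 * t\<^sup>2 * exp (y / 2 * t))"
        using t by (intro mult_left_mono) auto
      also have "\<dots> = h\<^sup>2 * (t ^ (n + 2) * (exp (- y * t) * exp (y / 2 * t)) * \<bar>\<phi> t\<bar>)"
        by (simp add: power_add power2_eq_square mult_ac)
      also have "exp (- y * t) * exp (y / 2 * t) = exp (- (y / 2) * t)"
        by (simp flip: exp_add)
      also have "t ^ n * exp (- y * t) * \<bar>\<phi> t\<bar> * \<bar>exp (- h * t) - 1 - (- h * t)\<bar>
          = \<bar>t ^ n * exp (- y * t) * \<phi> t * (exp (- h * t) - 1 - (- h * t))\<bar>"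
        using t by (simp add: abs_mult)
      also have "t ^ n * exp (- y * t) * \<phi> t * (exp (- h * t) - 1 - (- h * t))
          = t ^ n * (exp (- y * t) * exp (- h * t)) * \<phi> t - t ^ n * exp (- y * t) * \<phi> t + h * (t ^ Suc n * exp (- y * t) * \<phi> t)"
        by (simp add: algebra_simps)
      also have "exp (- y * t) * exp (- h * t) = exp (- (y + h) * t)"
        by (simp add: algebra_simps flip: exp_add)
      finally show ?thesis .
    qed
    then show "norm (?I t *\<^sub>R (t ^ n * exp (- (y + h) * t) * \<phi> t) - ?I t *\<^sub>R (t ^ n * exp (- y * t) * \<phi> t)
        - h * - (?I t *\<^sub>R (t ^ Suc n * exp (- y * t) * \<phi> t))) \<le> (norm h)\<^sup>2 * ?B t"
      by (auto simp: indicator_def)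
  qed (use y in simp)
  then show ?thesis
    unfolding set_lebesgue_integral_def by simp
qed

section \<open>The Bernstein criterion\<close>

lemma set_integrable_Phi_fun:
  assumes "a > 0" "0 \<le> c" "a + c < 3"
  shows "set_integrable lborel {0<..} (Phi_fun a c :: real \<Rightarrow> real)"
  using laplace_Phi_fun[OF assms, of 0] by (simp add: set_integrable_def has_bochner_integral_iff)

lemma H_fun_eq_laplace:
  assumes ac: "a > 0" "0 \<le> c" "a + c < 3" and y: "y > 0"
  shows "exp a - H_fun a c y = (LBINT t:{0<..}. exp (- y * t) * Phi_fun a c t)"
proof -
  have "(LBINT t:{0<..}. exp (- y * t) * Phi_fun a c t) = (1 + y)\<^sup>2 * (exp a - H_fun a c y) / (1 + y)\<^sup>2"
    using laplace_Phi_fun[OF ac, of y] y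
    by (simp add: H_fun_integral_representation[OF ac y] set_lebesgue_integral_def has_bochner_integral_iff)
  then show ?thesis
    using y by simp
qed

lemma has_field_derivative_higher_deriv_H_fun:
  assumes ac: "a > 0" "0 \<le> c" "a + c < 3" and y: "y > 0"
  shows "((deriv ^^ n) (H_fun a c) has_field_derivative
           (-1) ^ n * (LBINT t:{0<..}. t ^ Suc n * exp (- y * t) * Phi_fun a c t)) (at y)"
  using y
proof (induction n arbitrary: y)
  case 0
  have "((\<lambda>y. exp a - (LBINT t:{0<..}. t ^ 0 * exp (- y * t) * Phi_fun a c t)) has_field_derivative
      0 - - (LBINT t:{0<..}. t ^ Suc 0 * exp (- y * t) * Phi_fun a c t)) (at y)"
    by (intro DERIV_diff DERIV_const has_field_derivative_laplace_moment set_integrable_Phi_fun ac 0)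
  then have "(H_fun a c has_field_derivative 0 - - (LBINT t:{0<..}. t ^ Suc 0 * exp (- y * t) * Phi_fun a c t)) (at y)"
  proof (rule has_field_derivative_transform_within_open[of _ _ _ "{0<..}"])
    show "exp a - (LBINT t:{0<..}. t ^ 0 * exp (- x * t) * Phi_fun a c t) = H_fun a c x" if "x \<in> {0<..}" for x
      using H_fun_eq_laplace[OF ac, of x] that by simp
  qed (use 0 in auto)
  then show ?case by simp
next
  case (Suc n)
  let ?L = "\<lambda>m (y::real). LBINT t:{0<..}. (t::real) ^ m * exp (- y * t) * Phi_fun a c t"
  have "((\<lambda>y. (-1) ^ n * ?L (Suc n) y) has_field_derivative (-1) ^ n * - ?L (Suc (Suc n)) y) (at y)"
    by (intro DERIV_cmult has_field_derivative_laplace_moment set_integrable_Phi_fun ac Suc.prems)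
  then have "((deriv ^^ Suc n) (H_fun a c) has_field_derivative (-1) ^ n * - ?L (Suc (Suc n)) y) (at y)"
  proof (rule has_field_derivative_transform_within_open[of _ _ _ "{0<..}"])
    show "(-1) ^ n * ?L (Suc n) x = (deriv ^^ Suc n) (H_fun a c) x" if "x \<in> {0<..}" for x
      using DERIV_imp_deriv[OF Suc.IH[of x]] that by simp
  qed (use Suc.prems in auto)
  then show ?case by simp
qed

lemma smooth_on_pos_deriv: "smooth_on_pos f \<Longrightarrow> smooth_on_pos (deriv f)"
  unfolding smooth_on_pos_def by (metis comp_apply funpow_Suc_right)

text \<open>By \<open>has_field_derivative_higher_deriv_H_fun\<close>, \<open>(-1)\<^sup>n\<close> times the \<open>n\<close>-th derivative of \<open>H'\<close> is a moment integral of \<open>\<Phi>\<close>, of order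
\<open>n + 1\<close>. Where \<open>D < 0\<close>, also \<open>\<Phi> < 0\<close>; the point \<open>t = 0\<close>, to which \<open>laplace_moment_neg\<close> does not apply, is harmless because \<open>D(0) = q\<^sub>1 > 0\<close>.\<close>

lemma bernstein_H_fun_iff:
  assumes ac: "a > 0" "0 \<le> c" "a + c < 3"
  shows "bernstein_function (H_fun a c) \<longleftrightarrow> (\<forall>t::real. t \<ge> 0 \<longrightarrow> D_fun a c t \<ge> 0)"
proof -
  let ?H = "H_fun a c"
  let ?L = "\<lambda>m (y::real). LBINT t:{0<..}. (t::real) ^ m * exp (- y * t) * Phi_fun a c t"
  have smooth: "smooth_on_pos ?H"
    unfolding smooth_on_pos_def
    using has_field_derivative_higher_deriv_H_fun[OF ac] unfolding real_differentiable_def by blast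
  have nonneg: "?H x \<ge> 0" for x
    by (simp add: H_fun_def)
  have sgn: "(-1) ^ n * (deriv ^^ n) (deriv ?H) y = ?L (Suc n) y" if "y > 0" for n y
  proof -
    have "(deriv ^^ n) (deriv ?H) y = (deriv ^^ Suc n) ?H y"
      by (simp only: funpow_Suc_right comp_apply)
    also have "\<dots> = (-1) ^ n * ?L (Suc n) y"
      using DERIV_imp_deriv[OF has_field_derivative_higher_deriv_H_fun[OF ac that]] by simp
    finally show ?thesis
      by (simp flip: power_mult_distrib mult.assoc)
  qed
  have "bernstein_function ?H \<longleftrightarrow> (\<forall>n. \<forall>y>0. ?L (Suc n) y \<ge> 0)"
    unfolding bernstein_function_def completely_monotone_def
    using smooth smooth_on_pos_deriv[OF smooth] nonneg sgn by simp
  also have "\<dots> \<longleftrightarrow> (\<forall>t::real. t \<ge> 0 \<longrightarrow> D_fun a c t \<ge> 0)"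
  proof (intro iffI allI impI)
    fix t :: real
    assume L: "\<forall>n. \<forall>y>0. ?L (Suc n) y \<ge> 0" and t: "t \<ge> 0"
    show "D_fun a c t \<ge> 0"
    proof (rule ccontr)
      assume neg: "\<not> D_fun a c t \<ge> 0"
      have "D_fun a c (0::real) = q1 a c"
        by (simp add: D_fun_def D_integrand_def[abs_def] set_lebesgue_integral_def)
      then have t0: "t > 0"
        using neg t ac by (cases "t = 0") (auto simp: q1_def)
      have "isCont (D_fun a c) t"
        using has_field_derivative_D_fun[OF ac] by (rule DERIV_isCont)
      then have "isCont (Phi_fun a c) t"
        unfolding Phi_fun_def[abs_def] by (intro continuous_intros)
      moreover have "Phi_fun a c t < 0"
        using neg by (simp add: Phi_fun_def mult_less_0_iff)
      ultimately obtain n y where ny: "n > 0" "y > 0" "?L n y < 0"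
        using laplace_moment_neg[OF set_integrable_Phi_fun[OF ac] _ t0] by blast
      obtain m where "n = Suc m"
        using ny(1) gr0_conv_Suc by blast
      then have "?L n y \<ge> 0"
        using L ny(2) by blast
      then show False
        using ny(3) by linarith
    qed
  next
    fix n and y :: real
    assume D: "\<forall>t::real. t \<ge> 0 \<longrightarrow> D_fun a c t \<ge> 0" and y: "y > 0"
    show "?L (Suc n) y \<ge> 0"
      unfolding set_lebesgue_integral_def
      using D by (intro Bochner_Integration.integral_nonneg) (auto simp: indicator_def Phi_fun_def)
  qed
  finally show ?thesis .
qed

theorem proposition3:
  fixes a c :: real
  assumes "a > 0" and "0 \<le> c" and "c < 1" and "a + c < 3"
  shows "(\<forall>t::complex. set_integrable lborel {0<..<1} (D_integrand a c t))
    \<and> (D_fun a c :: complex \<Rightarrow> complex) holomorphic_on UNIV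
    \<and> (Phi_fun a c :: complex \<Rightarrow> complex) holomorphic_on UNIV
    \<and> set_integrable lborel {0<..} (Phi_fun a c :: real \<Rightarrow> real)
    \<and> (\<forall>y::real. y > 0 \<longrightarrow>
         exp a - H_fun a c y = (LBINT t:{0<..}. exp (- y * t) * Phi_fun a c t))
    \<and> (bernstein_function (H_fun a c) \<longleftrightarrow> (\<forall>t::real. t \<ge> 0 \<longrightarrow> D_fun a c t \<ge> 0))
    \<and> (\<forall>n::nat. n \<ge> 2 \<longrightarrow>
         (\<forall>t::complex. set_integrable lborel {0<..<1} (D_deriv_integrand a c n t)
            \<and> (deriv ^^ n) (D_fun a c) t
                = of_real (exp (- a)) * (LBINT s:{0<..<1}. D_deriv_integrand a c n t s))
       \<and> (\<forall>t::real. (deriv ^^ n) (D_fun a c) t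
                = exp (- a) * (LBINT s:{0<..<1}. D_deriv_integrand a c n t s)))"
proof (intro conjI allI impI)
  note ac = assms(1,2,4)
  show "set_integrable lborel {0<..<1} (D_integrand a c t)" for t :: complex
    using set_integrable_D_integrand_deriv[OF ac, of 0 t] by (simp add: D_integrand_deriv_0)
  show D: "(D_fun a c :: complex \<Rightarrow> complex) holomorphic_on UNIV"
    using has_field_derivative_D_fun[OF ac] by (auto simp: holomorphic_on_open)
  show "(Phi_fun a c :: complex \<Rightarrow> complex) holomorphic_on UNIV"
    unfolding Phi_fun_def[abs_def] by (intro holomorphic_intros D)
  show "set_integrable lborel {0<..} (Phi_fun a c :: real \<Rightarrow> real)"
    by (rule set_integrable_Phi_fun[OF ac])
  show "exp a - H_fun a c y = (LBINT t:{0<..}. exp (- y * t) * Phi_fun a c t)" if "y > 0" for y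
    by (rule H_fun_eq_laplace[OF ac that])
  show "bernstein_function (H_fun a c) \<longleftrightarrow> (\<forall>t::real. t \<ge> 0 \<longrightarrow> D_fun a c t \<ge> 0)"
    by (rule bernstein_H_fun_iff[OF ac])
  fix n :: nat assume n: "n \<ge> 2"
  show "set_integrable lborel {0<..<1} (D_deriv_integrand a c n t)" for t :: complex
    using set_integrable_D_integrand_deriv[OF ac, of n t] n by (simp add: D_integrand_deriv_ge_2)
  show "(deriv ^^ n) (D_fun a c) t = of_real (exp (- a)) * (LBINT s:{0<..<1}. D_deriv_integrand a c n t s)" for t :: complex
    by (rule deriv_D_fun[OF ac n])
  show "(deriv ^^ n) (D_fun a c) t = exp (- a) * (LBINT s:{0<..<1}. D_deriv_integrand a c n t s)" for t :: real
    using deriv_D_fun[OF ac n, of t] by simp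
qed

end
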